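(* Let $N\in\mathbb{N}$, $T>0$, let $a_2,a_{1,1},\dots,a_{1,N},a_0\in C([0,T];\mathbb{C})$ and consider $$P(t,D_x,D_t)=D_t-a_2(t)\Delta_x+\sum_{j=1}^N a_{1,j}(t)D_{x_j}+a_0(t)$$ and the Cauchy problem $Pu(t,x)=f(t,x)$, $u(0,x)=g(x)$, for $t\in[0,T]$, $x\in\mathbb{T}^N$. If there exists $t^\star\in[0,T]$ such that $\operatorname{Im}(a_2(t^\star))>0$, then this Cauchy problem is not well-posed in $C^\omega$ $(=G^1)$, which implies that it is not well-posed in $G^s$ for any $s\ge1$, nor in $C^\infty$, nor in $H^r$.
   Context: $\mathbb{T}^N=\mathbb{R}^N/2\pi\mathbb{Z}^N$, $D_t=\frac1i\partial_t$, $D_{x_j}=\frac1i\partial_{x_j}$, $\Delta_x=\sum_j\partial_{x_j}^2$. Spaces. For a distribution $u$ on $\mathbb{T}^N$ its Fourier coefficients are $\widehat u(\xi)=\langle u,e^{-ix\xi}\rangle$, $\xi\in\mathbb{Z}^N$, normalized so that $u=\sum_\xi\widehat u(\xi)e^{ix\xi}$. For $r\in\mathbb{R}$, $H^r(\mathbb{T}^N)$ is the set of distributions with $\|u\|_{H^r}^2=\sum_{\xi}|\widehat u(\xi)|^2(1+|\xi|)^{2r}<\infty$. $C^\infty(\mathbb{T}^N)=\bigcap_r H^r(\mathbb{T}^N)$ carries the projective limit topology. For $s\ge1$, $G^s(\mathbb{T}^N)$ is the set of $f\in C^\infty(\mathbb{T}^N)$ for which there are $C,h>0$ with $|D^\alpha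 f(x)|\le Ch^{|\alpha|}|\alpha|!^s$ for all multi-indices $\alpha$ and all $x$. With $\|f\|_{h,s}=\sup_\alpha \|D^\alpha f\|_\infty/(h^{|\alpha|}|\alpha|!^s)$ and $G^s_h(\mathbb{T}^N)=\{f:\|f\|_{h,s}<\infty\}$, $G^s(\mathbb{T}^N)$ carries the (locally convex) inductive limit topology of the Banach spaces $G^s_h(\mathbb{T}^N)$, $h\to\infty$. $C^\omega(\mathbb{T}^N)=G^1(\mathbb{T}^N)$. $C([0,T];X)$ denotes the continuous maps $[0,T]\to X$. Solutions. $u\in C([0,T];H^\rho(\mathbb{T}^N))$ (some $\rho\in\mathbb{R}$) solves the Cauchy problem if $u(0)=g$ and $Pu=f$ holds with $D_tu$ understood as the weak derivative in $t$ on $(0,T)$: $\langle D_tu,\varphi\rangle=\int_0^T u(t)(-D_t\varphi(t))\,dt$ for $\varphi\in C_c^\infty((0,T))$. Well-posedness. The Cauchy problem is well-posed in $H^r$ if for every $r\in\mathbb{R}$, $f\in C([0,T];H^r(\mathbb{T}^N))$ and $g\in H^r(\mathbb{T}^N)$ there is a unique solution $u\in C([0,T];H^r(\mathbb{T}^N))$. It is well-posed in $C^\infty$ (resp. in $G^s$, for a fixed $s\ge1$) if for every $f\in C([0,T];X)$ and $g\in X$ there is a unique solution $u\in C([0,T];X)$, where $X=C^\infty(\mathbb{T}^N)$ (resp. $X=G^s(\mathbb{T}^N)$). *)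

theory Defs
  imports "HOL-Analysis.Analysis"
begin

section \<open>Smooth functions\<close>

definition dir_deriv :: "'a::euclidean_space \<Rightarrow> ('a \<Rightarrow> complex) \<Rightarrow> 'a \<Rightarrow> complex" where
  "dir_deriv b f x = vector_derivative (\<lambda>h. f (x + h *\<^sub>R b)) (at 0)"

text \<open>All iterated partial derivatives exist and are Frechet differentiable (hence continuous).\<close>

definition smooth :: "('a::euclidean_space \<Rightarrow> complex) \<Rightarrow> bool" where
  "smooth f \<longleftrightarrow> (\<forall>bs \<in> lists Basis. foldr dir_deriv bs f differentiable_on UNIV)"

definition D_x :: "'n \<Rightarrow> (real^'n::finite \<Rightarrow> complex) \<Rightarrow> real^'n \<Rightarrow> complex" where
  "D_x j f = (\<lambda>x. (1 / \<i>) * dir_deriv (axis j 1) f x)"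

definition D_t :: "(real \<Rightarrow> complex) \<Rightarrow> real \<Rightarrow> complex" where
  "D_t \<phi> = (\<lambda>t. (1 / \<i>) * vector_derivative \<phi> (at t))"

text \<open>Multi-indices are functions \<open>'n \<Rightarrow> nat\<close>. The composition of the powers of the \<open>D_x j\<close>
  is taken along a fixed enumeration of the coordinates; on smooth functions the order is
  immaterial by Schwarz's theorem.\<close>

definition coord_list :: "'n::finite list" where
  "coord_list = (SOME js. distinct js \<and> set js = UNIV)"

definition D_multi :: "('n \<Rightarrow> nat) \<Rightarrow> (real^'n::finite \<Rightarrow> complex) \<Rightarrow> real^'n \<Rightarrow> complex" where
  "D_multi \<alpha> f = foldr (\<lambda>j. D_x j ^^ \<alpha> j) coord_list f"

definition mlength :: "('n::finite \<Rightarrow> nat) \<Rightarrow> nat" where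
  "mlength \<alpha> = (\<Sum>j\<in>UNIV. \<alpha> j)"

section \<open>Distributions on the torus\<close>

text \<open>A function on the torus \<open>\<real>\<^sup>N / 2\<pi>\<int>\<^sup>N\<close> is a function on \<open>\<real>\<^sup>N\<close> that is \<open>2\<pi>\<close>-periodic in every
  coordinate; \<open>N = CARD('n)\<close>.\<close>

definition torus_smooth :: "(real^'n::finite \<Rightarrow> complex) set" where
  "torus_smooth = {\<phi>. smooth \<phi> \<and> (\<forall>x j. \<phi> (x + axis j (2 * pi)) = \<phi> x)}"

type_synonym 'n functional = "(real^'n \<Rightarrow> complex) \<Rightarrow> complex"

text \<open>Distributions are the continuous linear functionals on the Frechet space
  \<open>torus_smooth\<close>. As HOL functions are total, they are normalised to be \<open>0\<close> outside
  \<open>torus_smooth\<close>, so that equality is equality of distributions.\<close>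

definition distributions :: "'n::finite functional set" where
  "distributions = {u.
     (\<forall>\<phi>. \<phi> \<notin> torus_smooth \<longrightarrow> u \<phi> = 0) \<and>
     (\<forall>\<phi>\<in>torus_smooth. \<forall>\<psi>\<in>torus_smooth. u (\<lambda>x. \<phi> x + \<psi> x) = u \<phi> + u \<psi>) \<and>
     (\<forall>\<phi>\<in>torus_smooth. \<forall>c. u (\<lambda>x. c * \<phi> x) = c * u \<phi>) \<and>
     (\<exists>C m. \<forall>\<phi>\<in>torus_smooth.
        norm (u \<phi>) \<le> C * (SUP (\<alpha>, x) \<in> {\<alpha>. mlength \<alpha> \<le> m} \<times> UNIV. norm (D_multi \<alpha> \<phi> x)))}"

text \<open>The embedding of functions into distributions uses the normalised measure
  \<open>(2\<pi>)\<^sup>-\<^sup>N dx\<close>; with it the Fourier coefficients below satisfy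
  \<open>u = \<Sum>\<xi>. fourier u \<xi> \<cdot> e\<^sup>i\<^sup>x\<^sup>\<xi>\<close>.\<close>

definition dist_of :: "(real^'n::finite \<Rightarrow> complex) \<Rightarrow> 'n functional" where
  "dist_of F \<phi> = (if \<phi> \<in> torus_smooth
     then integral (cbox 0 (\<chi> j. 2 * pi)) (\<lambda>x. F x * \<phi> x) / of_real ((2 * pi) ^ CARD('n))
     else 0)"

text \<open>The smooth function that a distribution is given by (if there is one).\<close>

definition fun_of :: "'n::finite functional \<Rightarrow> real^'n \<Rightarrow> complex" where
  "fun_of u = (THE F. F \<in> torus_smooth \<and> dist_of F = u)"

definition dist_D :: "'n::finite \<Rightarrow> 'n functional \<Rightarrow> 'n functional" where
  "dist_D j u \<psi> = (if \<psi> \<in> torus_smooth then - u (D_x j \<psi>) else 0)"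

definition dist_partial :: "'n::finite \<Rightarrow> 'n functional \<Rightarrow> 'n functional" where
  "dist_partial j u \<psi> = (if \<psi> \<in> torus_smooth then - u (dir_deriv (axis j 1) \<psi>) else 0)"

definition dist_Laplace :: "'n::finite functional \<Rightarrow> 'n functional" where
  "dist_Laplace u \<psi> = (\<Sum>j\<in>UNIV. dist_partial j (dist_partial j u) \<psi>)"

definition real_freq :: "int^'n::finite \<Rightarrow> real^'n" where
  "real_freq \<xi> = (\<chi> j. real_of_int (\<xi> $ j))"

definition fourier :: "'n::finite functional \<Rightarrow> int^'n \<Rightarrow> complex" where
  "fourier u \<xi> = u (\<lambda>x. exp (- \<i> * of_real (x \<bullet> real_freq \<xi>)))"

section \<open>Function spaces and their topologies\<close>

text \<open>The topology on \<open>X\<close> generated by a family \<open>P\<close> of seminorms on \<open>X\<close>.\<close>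

definition seminorm_topology ::
  "'n::finite functional set \<Rightarrow> ('n functional \<Rightarrow> real) set \<Rightarrow> 'n functional topology" where
  "seminorm_topology X P = topology_generated_by
     {{v \<in> X. p (\<lambda>\<phi>. v \<phi> - u \<phi>) < e} | p u e. p \<in> P \<and> u \<in> X \<and> 0 < e}"

definition seminorm_on :: "'n::finite functional set \<Rightarrow> ('n functional \<Rightarrow> real) \<Rightarrow> bool" where
  "seminorm_on X p \<longleftrightarrow>
     (\<forall>u\<in>X. \<forall>v\<in>X. p (\<lambda>\<phi>. u \<phi> + v \<phi>) \<le> p u + p v) \<and>
     (\<forall>u\<in>X. \<forall>c. p (\<lambda>\<phi>. c * u \<phi>) = norm c * p u)"

definition sobolev :: "real \<Rightarrow> 'n::finite functional set" where
  "sobolev r = {u \<in> distributions.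
     (\<lambda>\<xi>. (norm (fourier u \<xi>))\<^sup>2 * (1 + norm (real_freq \<xi>)) powr (2 * r)) summable_on UNIV}"

definition sobolev_norm :: "real \<Rightarrow> 'n::finite functional \<Rightarrow> real" where
  "sobolev_norm r u =
     sqrt (\<Sum>\<^sub>\<infinity>\<xi>. (norm (fourier u \<xi>))\<^sup>2 * (1 + norm (real_freq \<xi>)) powr (2 * r))"

definition sobolev_topology :: "real \<Rightarrow> 'n::finite functional topology" where
  "sobolev_topology r = seminorm_topology (sobolev r) {sobolev_norm r}"

definition C_infty :: "'n::finite functional set" where
  "C_infty = (\<Inter>r. sobolev r)"

text \<open>Projective limit: the coarsest topology for which all inclusions into \<open>sobolev r\<close> are
  continuous.\<close>

definition C_infty_topology :: "'n::finite functional topology" where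
  "C_infty_topology =
     topology_generated_by {C_infty \<inter> U | r U. openin (sobolev_topology r) U}"

definition gevrey :: "real \<Rightarrow> 'n::finite functional set" where
  "gevrey s = {u \<in> C_infty. \<exists>C>0. \<exists>h>0. \<forall>\<alpha> x.
     norm (D_multi \<alpha> (fun_of u) x) \<le> C * h ^ mlength \<alpha> * fact (mlength \<alpha>) powr s}"

definition gevrey_norm :: "real \<Rightarrow> real \<Rightarrow> 'n::finite functional \<Rightarrow> ennreal" where
  "gevrey_norm h s u = (SUP \<alpha>. (SUP x. ennreal (norm (D_multi \<alpha> (fun_of u) x)))
     / ennreal (h ^ mlength \<alpha> * fact (mlength \<alpha>) powr s))"

definition gevrey_step :: "real \<Rightarrow> real \<Rightarrow> 'n::finite functional set" where
  "gevrey_step h s = {u \<in> C_infty. gevrey_norm h s u < \<infinity>}"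

definition gevrey_step_topology :: "real \<Rightarrow> real \<Rightarrow> 'n::finite functional topology" where
  "gevrey_step_topology h s =
     seminorm_topology (gevrey_step h s) {\<lambda>u. enn2real (gevrey_norm h s u)}"

text \<open>Locally convex inductive limit: the finest locally convex topology on \<open>gevrey s\<close> for which
  all inclusions of the steps are continuous. It is generated by all seminorms whose
  restriction to every step is continuous.\<close>

definition gevrey_topology :: "real \<Rightarrow> 'n::finite functional topology" where
  "gevrey_topology s = seminorm_topology (gevrey s)
     {p. seminorm_on (gevrey s) p \<and>
         (\<forall>h>0. continuous_map (gevrey_step_topology h s) euclideanreal p)}"

text \<open>\<open>C([0,T];X)\<close>, where the topology of \<open>X\<close> is \<open>\<tau>\<close>. Functions are \<open>undefined\<close> outside \<open>[0,T]\<close>.\<close>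

definition curves :: "real \<Rightarrow> 'n::finite functional topology \<Rightarrow> (real \<Rightarrow> 'n functional) set" where
  "curves T \<tau> = {u \<in> extensional {0..T}. continuous_map (top_of_set {0..T}) \<tau> u}"

section \<open>The Cauchy problem\<close>

definition time_test :: "real \<Rightarrow> (real \<Rightarrow> complex) set" where
  "time_test T = {\<phi>. smooth \<phi> \<and>
     (\<exists>K. compact K \<and> K \<subseteq> {0<..<T} \<and> (\<forall>t. t \<notin> K \<longrightarrow> \<phi> t = 0))}"

text \<open>\<open>\<integral>\<^sub>0\<^sup>T v(t) \<phi>(t) dt\<close> for a distribution-valued \<open>v\<close>: the integral is evaluated on the
  spatial test functions \<open>\<psi>\<close>.\<close>

definition time_integral ::
  "real \<Rightarrow> (real \<Rightarrow> 'n::finite functional) \<Rightarrow> (real \<Rightarrow> complex) \<Rightarrow> 'n functional" where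
  "time_integral T v \<phi> \<psi> = integral {0..T} (\<lambda>t. v t \<psi> * \<phi> t)"

definition weak_D_t ::
  "real \<Rightarrow> (real \<Rightarrow> 'n::finite functional) \<Rightarrow> (real \<Rightarrow> complex) \<Rightarrow> 'n functional" where
  "weak_D_t T u \<phi> = time_integral T u (\<lambda>t. - D_t \<phi> t)"

definition spatial_part ::
  "(real \<Rightarrow> complex) \<Rightarrow> ('n \<Rightarrow> real \<Rightarrow> complex) \<Rightarrow> (real \<Rightarrow> complex) \<Rightarrow>
   (real \<Rightarrow> 'n::finite functional) \<Rightarrow> real \<Rightarrow> 'n functional" where
  "spatial_part a2 a1 a0 u t \<psi> =
     - a2 t * dist_Laplace (u t) \<psi> + (\<Sum>j\<in>UNIV. a1 j t * dist_D j (u t) \<psi>) + a0 t * u t \<psi>"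

definition solves_Cauchy ::
  "real \<Rightarrow> (real \<Rightarrow> complex) \<Rightarrow> ('n \<Rightarrow> real \<Rightarrow> complex) \<Rightarrow> (real \<Rightarrow> complex) \<Rightarrow>
   (real \<Rightarrow> 'n::finite functional) \<Rightarrow> 'n functional \<Rightarrow> (real \<Rightarrow> 'n functional) \<Rightarrow> bool" where
  "solves_Cauchy T a2 a1 a0 f g u \<longleftrightarrow>
     (\<exists>\<rho>. u \<in> curves T (sobolev_topology \<rho>)) \<and>
     u 0 = g \<and>
     (\<forall>\<phi> \<in> time_test T. \<forall>\<psi> \<in> torus_smooth.
        weak_D_t T u \<phi> \<psi> + time_integral T (spatial_part a2 a1 a0 u) \<phi> \<psi>
        = time_integral T f \<phi> \<psi>)"

definition well_posed ::
  "real \<Rightarrow> (real \<Rightarrow> complex) \<Rightarrow> ('n \<Rightarrow> real \<Rightarrow> complex) \<Rightarrow> (real \<Rightarrow> complex) \<Rightarrow>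
   'n::finite functional set \<Rightarrow> 'n functional topology \<Rightarrow> bool" where
  "well_posed T a2 a1 a0 X \<tau> \<longleftrightarrow>
     (\<forall>f \<in> curves T \<tau>. \<forall>g \<in> X. \<exists>!u. u \<in> curves T \<tau> \<and> solves_Cauchy T a2 a1 a0 f g u)"

text \<open>Well-posedness in Sobolev spaces is required in all orders \<open>r\<close> simultaneously.\<close>

definition well_posed_sobolev ::
  "real \<Rightarrow> (real \<Rightarrow> complex) \<Rightarrow> ('n::finite \<Rightarrow> real \<Rightarrow> complex) \<Rightarrow> (real \<Rightarrow> complex) \<Rightarrow> bool" where
  "well_posed_sobolev T a2 a1 a0 \<longleftrightarrow>
     (\<forall>r. well_posed T a2 a1 a0 (sobolev r) (sobolev_topology r))"

definition well_posed_C_infty ::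
  "real \<Rightarrow> (real \<Rightarrow> complex) \<Rightarrow> ('n::finite \<Rightarrow> real \<Rightarrow> complex) \<Rightarrow> (real \<Rightarrow> complex) \<Rightarrow> bool" where
  "well_posed_C_infty T a2 a1 a0 \<longleftrightarrow> well_posed T a2 a1 a0 C_infty C_infty_topology"

definition well_posed_gevrey ::
  "real \<Rightarrow> real \<Rightarrow> (real \<Rightarrow> complex) \<Rightarrow> ('n::finite \<Rightarrow> real \<Rightarrow> complex) \<Rightarrow> (real \<Rightarrow> complex) \<Rightarrow> bool"
  where
  "well_posed_gevrey s T a2 a1 a0 \<longleftrightarrow> well_posed T a2 a1 a0 (gevrey s) (gevrey_topology s)"

definition well_posed_analytic ::
  "real \<Rightarrow> (real \<Rightarrow> complex) \<Rightarrow> ('n::finite \<Rightarrow> real \<Rightarrow> complex) \<Rightarrow> (real \<Rightarrow> complex) \<Rightarrow> bool" where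
  "well_posed_analytic = well_posed_gevrey 1"

end

theory Submission
  imports Defs "HOL-Real_Asymp.Real_Asymp"
begin

text \<open>On the Fourier coefficient at frequency \<open>\<xi>\<close> the equation is \<open>y' = \<i> (f - q y)\<close> with
  \<open>Re (-\<i> q) = Im a2 |\<xi>|\<^sup>2 + O(1 + |\<xi>|)\<close>, so on an interval \<open>[\<alpha>, \<beta>]\<close> with \<open>Im a2 \<ge> \<gamma> > 0\<close> the
  homogeneous solution \<open>E\<close> with \<open>E(m) = 1\<close> at the midpoint \<open>m\<close> is bounded on \<open>[\<alpha>, m]\<close> uniformly in
  \<open>\<xi>\<close>, but is at least \<open>exp (c |\<xi>|\<^sup>2)\<close> at \<open>\<beta>\<close>. Force the modes \<open>e\<^sup>i\<^sup>k\<^sup>x\<close> (one fixed coordinate) one after the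
  other, in disjoint time windows in \<open>[\<alpha>, m]\<close> of length about \<open>k\<^sup>-\<^sup>2\<close>, with amplitude
  \<open>exp (-k) \<cdot> pulse \<cdot> E\<close>. The force is a continuous curve in every space considered, but the \<open>k\<close>-th
  coefficient of a solution at \<open>\<beta>\<close> outgrows every power of \<open>k\<close>, so that no solution exists in any
  Sobolev space. Since only one mode is active at each time, all values of the force are
  trigonometric monomials and no series of functions occurs.\<close>

section \<open>Smooth functions\<close>

text \<open>A force is used rather than an initial datum because Im a2 may be negative before the
  window: a datum at time 0 could be damped there by more than the window amplifies it. With the
  homogeneous solution as a factor of the force no oscillatory cancellation can occur: after
  multiplication by the integrating factor the integrand is a nonnegative pulse times a constant.
  The rate exp (-k) sits between two scales. In the Gevrey step with constant 2 the norm of the k-th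
  mode is at most exp (k / 2) for every s >= 1, which exp (-k) beats; against exp (c k^2) the loss
  of exp (-k), and of the powers of k caused by the short time windows, is negligible. The delicate
  half is the continuity of the force. The topologies are generated by balls around arbitrary
  centres of the space, so differences between the force and elements about which nothing more is
  known have to be estimated too.\<close>

lemma dir_deriv_eq:
  assumes "(f has_derivative f') (at x)"
  shows "dir_deriv b f x = f' b"
proof -
  have 1: "((\<lambda>h. x + h *\<^sub>R b) has_derivative (\<lambda>h. h *\<^sub>R b)) (at 0)"
    by (auto intro!: derivative_eq_intros)
  have "((\<lambda>h. f (x + h *\<^sub>R b)) has_derivative (\<lambda>h. f' (h *\<^sub>R b))) (at 0)"
    using diff_chain_at[OF 1, of f f'] assms by (simp add: o_def)
  moreover have "f' (h *\<^sub>R b) = h *\<^sub>R f' b" for h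
    using has_derivative_linear[OF assms] by (simp add: linear_cmul)
  ultimately have "((\<lambda>h. f (x + h *\<^sub>R b)) has_vector_derivative f' b) (at 0)"
    by (simp add: has_vector_derivative_def)
  then show ?thesis
    unfolding dir_deriv_def by (rule vector_derivative_at)
qed

text \<open>Iterated derivatives never leave a class that is closed under \<open>dir_deriv\<close>,
  so differentiability of its members is enough. The later smoothness proofs only have to exhibit
  such a class: sums, sums of products, multiples of a mode, flat functions.\<close>

lemma smooth_coinduct [consumes 1, case_names closed]:
  assumes "P f"
    and "\<And>f. P f \<Longrightarrow> f differentiable_on UNIV \<and> (\<forall>b\<in>Basis. P (dir_deriv b f))"
  shows "smooth f"
proof -
  have "P (foldr dir_deriv bs f)" if "bs \<in> lists Basis" for bs
    using that by induction (use assms in auto)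
  then show ?thesis
    using assms unfolding smooth_def by blast
qed

lemma smooth_imp_differentiable: "smooth f \<Longrightarrow> f differentiable (at x)"
  unfolding smooth_def by (drule bspec[where x = "[]"]) (auto simp: differentiable_on_def)

lemma smooth_has_derivative:
  assumes "smooth f"
  obtains f' where "(f has_derivative f') (at x)"
  using smooth_imp_differentiable[OF assms] unfolding differentiable_def by blast

lemma smooth_imp_continuous_on: "smooth f \<Longrightarrow> continuous_on S f"
  by (meson smooth_imp_differentiable differentiable_imp_continuous_within
      continuous_at_imp_continuous_on)

lemma smooth_dir_deriv:
  assumes "smooth f" "b \<in> Basis"
  shows "smooth (dir_deriv b f)"
  unfolding smooth_def
proof
  fix bs :: "'a list" assume "bs \<in> lists Basis"
  \<comment> \<open>\<open>foldr\<close> applies the last entry of the list first, so appending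
    \<open>b\<close> differentiates along \<open>b\<close> before all others.\<close>
  then have "bs @ [b] \<in> lists Basis" using assms by auto
  then have "foldr dir_deriv (bs @ [b]) f differentiable_on UNIV"
    using assms unfolding smooth_def by blast
  then show "foldr dir_deriv bs (dir_deriv b f) differentiable_on UNIV" by simp
qed

lemma dir_deriv_add:
  assumes "smooth f" "smooth g"
  shows "dir_deriv b (\<lambda>x. f x + g x) = (\<lambda>x. dir_deriv b f x + dir_deriv b g x)"
proof
  fix x
  obtain f' g' where "(f has_derivative f') (at x)" "(g has_derivative g') (at x)"
    using assms by (metis smooth_has_derivative)
  then show "dir_deriv b (\<lambda>x. f x + g x) x = dir_deriv b f x + dir_deriv b g x"
    by (simp add: dir_deriv_eq[OF has_derivative_add] dir_deriv_eq)
qed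

lemma smooth_add:
  assumes "smooth f" "smooth g"
  shows "smooth (\<lambda>x. f x + g x)"
proof -
  define P where "P h \<longleftrightarrow> (\<exists>f g. smooth f \<and> smooth g \<and> h = (\<lambda>x. f x + g x))" for h :: "'a \<Rightarrow> complex"
  have "P (\<lambda>x. f x + g x)" using assms P_def by blast
  then show ?thesis
  proof (rule smooth_coinduct[where P = P])
    fix h assume "P h"
    then obtain f g where fg: "smooth f" "smooth g" "h = (\<lambda>x. f x + g x)" using P_def by blast
    show "h differentiable_on UNIV \<and> (\<forall>b\<in>Basis. P (dir_deriv b h))"
    proof (intro conjI ballI)
      show "h differentiable_on UNIV"
        using smooth_imp_differentiable[OF fg(1)] smooth_imp_differentiable[OF fg(2)]
        by (auto simp: differentiable_on_def fg(3))
      fix b :: 'a assume "b \<in> Basis"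
      then show "P (dir_deriv b h)"
        unfolding P_def fg(3) dir_deriv_add[OF fg(1,2)] using fg smooth_dir_deriv by blast
    qed
  qed
qed

lemma dir_deriv_bounded_linear:
  assumes "smooth f" "bounded_linear L"
  shows "dir_deriv b (\<lambda>x. L (f x)) = (\<lambda>x. L (dir_deriv b f x))"
proof
  fix x
  obtain f' where f': "(f has_derivative f') (at x)"
    using assms by (metis smooth_has_derivative)
  have "((\<lambda>x. L (f x)) has_derivative (\<lambda>h. L (f' h))) (at x)"
    using bounded_linear.has_derivative[OF assms(2) f'] .
  then show "dir_deriv b (\<lambda>x. L (f x)) x = L (dir_deriv b f x)"
    using f' by (simp add: dir_deriv_eq)
qed

lemma smooth_bounded_linear:
  assumes "smooth f" "bounded_linear L"
  shows "smooth (\<lambda>x. L (f x))"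
proof -
  define P where "P h \<longleftrightarrow> (\<exists>f. smooth f \<and> h = (\<lambda>x. L (f x)))" for h :: "'a \<Rightarrow> complex"
  have "P (\<lambda>x. L (f x))" using assms P_def by blast
  then show ?thesis
  proof (rule smooth_coinduct[where P = P])
    fix h assume "P h"
    then obtain f where f: "smooth f" "h = (\<lambda>x. L (f x))" using P_def by blast
    show "h differentiable_on UNIV \<and> (\<forall>b\<in>Basis. P (dir_deriv b h))"
    proof (intro conjI ballI)
      show "h differentiable_on UNIV"
        unfolding f(2) differentiable_on_def differentiable_def
        by (metis bounded_linear.has_derivative[OF assms(2)] smooth_has_derivative[OF f(1)])
      fix b :: 'a assume "b \<in> Basis"
      then show "P (dir_deriv b h)"
        unfolding P_def f(2) dir_deriv_bounded_linear[OF f(1) assms(2)]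
        using f smooth_dir_deriv by blast
    qed
  qed
qed

lemma smooth_cmult: "smooth f \<Longrightarrow> smooth (\<lambda>x. c * f x)"
  by (rule smooth_bounded_linear[where L = "(*) c"]) (auto intro: bounded_linear_mult_right)

lemma dir_deriv_cmult: "smooth f \<Longrightarrow> dir_deriv b (\<lambda>x. c * f x) = (\<lambda>x. c * dir_deriv b f x)"
  by (rule dir_deriv_bounded_linear[where L = "(*) c"]) (auto intro: bounded_linear_mult_right)

text \<open>The derivative of a product is a sum of two products, so products alone are not closed
  under differentiation. This is the closure to which \<open>smooth_coinduct\<close>
  applies.\<close>

inductive sum_of_products :: "('a::euclidean_space \<Rightarrow> complex) \<Rightarrow> bool" where
  product: "smooth f \<Longrightarrow> smooth g \<Longrightarrow> sum_of_products (\<lambda>x. f x * g x)"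
| sum: "sum_of_products f \<Longrightarrow> sum_of_products g \<Longrightarrow> sum_of_products (\<lambda>x. f x + g x)"

lemma sum_of_products_deriv:
  assumes "sum_of_products f"
  shows "f differentiable_on UNIV \<and> (\<forall>b\<in>Basis. sum_of_products (dir_deriv b f))"
  using assms
proof induction
  case (product f g)
  have d: "f differentiable (at x)" "g differentiable (at x)" for x
    using product by (auto intro: smooth_imp_differentiable)
  have "dir_deriv b (\<lambda>x. f x * g x) = (\<lambda>x. f x * dir_deriv b g x + dir_deriv b f x * g x)" for b
  proof
    fix x
    obtain f' g' where "(f has_derivative f') (at x)" "(g has_derivative g') (at x)"
      using product by (metis smooth_has_derivative)
    then show "dir_deriv b (\<lambda>x. f x * g x) x = f x * dir_deriv b g x + dir_deriv b f x * g x"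
      by (simp add: dir_deriv_eq[OF has_derivative_mult] dir_deriv_eq)
  qed
  then show ?case
    using d product smooth_dir_deriv
    by (auto simp: differentiable_on_def intro!: sum_of_products.intros differentiable_mult)
next
  case (sum f g)
  then have d: "f differentiable (at x)" "g differentiable (at x)" for x
    by (auto simp: differentiable_on_def)
  have "dir_deriv b (\<lambda>x. f x + g x) = (\<lambda>x. dir_deriv b f x + dir_deriv b g x)" for b
  proof
    fix x
    obtain f' g' where "(f has_derivative f') (at x)" "(g has_derivative g') (at x)"
      using d unfolding differentiable_def by blast
    then show "dir_deriv b (\<lambda>x. f x + g x) x = dir_deriv b f x + dir_deriv b g x"
      by (simp add: dir_deriv_eq[OF has_derivative_add] dir_deriv_eq)
  qed
  then show ?case
    using sum d by (auto simp: differentiable_on_def intro!: sum_of_products.intros)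
qed

lemma smooth_mult:
  assumes "smooth f" "smooth g"
  shows "smooth (\<lambda>x. f x * g x)"
  using sum_of_products.product[OF assms]
  by (rule smooth_coinduct[where P = sum_of_products]) (rule sum_of_products_deriv)

section \<open>Periodic smooth functions\<close>

lemma torus_smooth_imp_smooth: "F \<in> torus_smooth \<Longrightarrow> smooth F"
  by (simp add: torus_smooth_def)

lemma torus_smooth_periodic: "F \<in> torus_smooth \<Longrightarrow> F (x + axis j (2 * pi)) = F x"
  by (simp add: torus_smooth_def)

lemma torus_smooth_continuous_on: "F \<in> torus_smooth \<Longrightarrow> continuous_on S F"
  using smooth_imp_continuous_on torus_smooth_imp_smooth by blast

lemma torus_smooth_combination:
  assumes "F \<in> torus_smooth" "G \<in> torus_smooth"
  shows "(\<lambda>x. a * F x + b * G x) \<in> torus_smooth"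
  using assms by (auto simp: torus_smooth_def intro!: smooth_add smooth_cmult)

lemma torus_smooth_cmult: "F \<in> torus_smooth \<Longrightarrow> (\<lambda>x. c * F x) \<in> torus_smooth"
  by (auto simp: torus_smooth_def intro!: smooth_cmult)

lemma torus_smooth_dir_deriv:
  assumes "F \<in> torus_smooth" "b \<in> Basis"
  shows "dir_deriv b F \<in> torus_smooth"
proof -
  have "dir_deriv b F (x + axis j (2 * pi)) = dir_deriv b F x" for x j
  proof -
    have "F (x + axis j (2 * pi) + h *\<^sub>R b) = F (x + h *\<^sub>R b)" for h
      using torus_smooth_periodic[OF assms(1), of "x + h *\<^sub>R b" j] by (simp add: algebra_simps)
    then show ?thesis by (simp add: dir_deriv_def)
  qed
  then show ?thesis
    using assms smooth_dir_deriv by (auto simp: torus_smooth_def)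
qed

text \<open>Linearity is asked for on \<open>torus_smooth\<close> only, since
  \<open>vector_derivative\<close> is arbitrary where a function is not differentiable. Invariance
  of \<open>torus_smooth\<close> belongs to the notion so that it survives composition and passes
  from \<open>D_x\<close> to \<open>D_multi\<close>.\<close>

definition torus_linear :: "((real^'n::finite \<Rightarrow> complex) \<Rightarrow> real^'n \<Rightarrow> complex) \<Rightarrow> bool" where
  "torus_linear L \<longleftrightarrow> (\<forall>F\<in>torus_smooth. L F \<in> torus_smooth) \<and>
     (\<forall>F\<in>torus_smooth. \<forall>G\<in>torus_smooth. \<forall>a b.
        L (\<lambda>x. a * F x + b * G x) = (\<lambda>x. a * L F x + b * L G x))"

lemma torus_linear_id: "torus_linear (\<lambda>F. F)"
  by (simp add: torus_linear_def)

lemma torus_linear_comp: "torus_linear L \<Longrightarrow> torus_linear M \<Longrightarrow> torus_linear (\<lambda>F. L (M F))"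
  by (simp add: torus_linear_def)

lemma axis_in_Basis: "axis j (1::real) \<in> Basis"
  by (simp add: axis_in_Basis_iff)

lemma torus_linear_D_x: "torus_linear (D_x j)"
  unfolding torus_linear_def
proof (intro conjI ballI allI)
  fix F :: "real^'a \<Rightarrow> complex" assume "F \<in> torus_smooth"
  then show "D_x j F \<in> torus_smooth"
    unfolding D_x_def by (intro torus_smooth_cmult torus_smooth_dir_deriv axis_in_Basis)
next
  fix F G :: "real^'a \<Rightarrow> complex" and a b assume "F \<in> torus_smooth" "G \<in> torus_smooth"
  then show "D_x j (\<lambda>x. a * F x + b * G x) = (\<lambda>x. a * D_x j F x + b * D_x j G x)"
    by (auto simp: D_x_def dir_deriv_add dir_deriv_cmult smooth_cmult torus_smooth_imp_smooth
        algebra_simps)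
qed

lemma torus_linear_funpow: "torus_linear L \<Longrightarrow> torus_linear (L ^^ n)"
proof (induction n)
  case 0
  then show ?case using torus_linear_id by (simp add: id_def)
next
  case (Suc n)
  then show ?case using torus_linear_comp[of L "L ^^ n"] by (simp add: o_def)
qed

lemma torus_linear_D_multi: "torus_linear (D_multi \<alpha>)"
proof -
  have "torus_linear (\<lambda>f. foldr (\<lambda>j. D_x j ^^ \<alpha> j) js f)" for js
  proof (induction js)
    case Nil
    show ?case using torus_linear_id by simp
  next
    case (Cons j js)
    then show ?case
      using torus_linear_comp[OF torus_linear_funpow[OF torus_linear_D_x]] by simp
  qed
  then show ?thesis by (simp add: D_multi_def[abs_def])
qed

lemmas torus_smooth_D_multi = torus_linear_D_multi[unfolded torus_linear_def, THEN conjunct1, rule_format]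
lemmas D_multi_combination = torus_linear_D_multi[unfolded torus_linear_def, THEN conjunct2, rule_format]

section \<open>Reduction to one period\<close>

abbreviation period_box :: "(real^'n::finite) set" where
  "period_box \<equiv> cbox 0 (\<chi> j. 2 * pi)"

lemma torus_smooth_periodic_int:
  fixes F :: "real^'a::finite \<Rightarrow> complex"
  assumes "F \<in> torus_smooth"
  shows "F (x + axis j (2 * pi * real_of_int m)) = F x"
proof -
  have n: "F (x + axis j (2 * pi * real n)) = F x" for n x
  proof (induction n)
    case 0
    have "axis j 0 = (0 :: real^'a)" by (simp add: axis_def vec_eq_iff)
    then show ?case by (simp only: of_nat_0 mult_zero_right add_0_right)
  next
    case (Suc n)
    have "axis j (2 * pi * real (Suc n)) = axis j (2 * pi * real n) + axis j (2 * pi)"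
      by (auto simp: axis_def vec_eq_iff algebra_simps)
    then show ?case
      using Suc torus_smooth_periodic[OF assms] by (metis add.assoc)
  qed
  show ?thesis
  proof (cases "m \<ge> 0")
    case True
    then show ?thesis using n[of x "nat m"] by simp
  next
    case False
    have "x + axis j (2 * pi * real_of_int m) + axis j (2 * pi * real (nat (-m))) = x"
      using False by (auto simp: axis_def vec_eq_iff algebra_simps)
    then show ?thesis
      using n[of "x + axis j (2 * pi * real_of_int m)" "nat (- m)"] by (simp only:)
  qed
qed

text \<open>In each coordinate a whole number of periods is removed, which leaves the fractional
  part of \<open>x $ j / (2 * pi)\<close>. The point \<open>y\<close> is the same for all
  \<open>F\<close>.\<close>

lemma period_box_representative:
  fixes x :: "real^'n::finite"
  obtains y where "y \<in> period_box" "\<And>F. F \<in> torus_smooth \<Longrightarrow> F y = F x"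
proof -
  define m where "m = (\<lambda>j. - \<lfloor>x $ j / (2 * pi)\<rfloor>)"
  define s where "s A = (\<Sum>j\<in>A. axis j (2 * pi * real_of_int (m j)))" for A :: "'n set"
  have per: "F (x + s A) = F x" if "F \<in> torus_smooth" for F A
    using finite[of A]
  proof (induction A)
    case empty
    then show ?case by (simp add: s_def)
  next
    case (insert j A)
    have "F (x + s (insert j A)) = F (x + s A + axis j (2 * pi * real_of_int (m j)))"
      using insert by (simp add: s_def algebra_simps)
    then show ?case using insert torus_smooth_periodic_int[OF that] by simp
  qed
  have "s UNIV $ j = 2 * pi * real_of_int (m j)" for j
    by (simp add: s_def axis_def if_distrib sum.delta cong: if_cong)
  then have "(x + s UNIV) $ j \<in> {0..2 * pi}" for j
  proof -
    assume a: "\<And>j. s UNIV $ j = 2 * pi * real_of_int (m j)"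
    have "(x + s UNIV) $ j = 2 * pi * frac (x $ j / (2 * pi))"
      by (simp add: a m_def frac_def field_simps)
    moreover have "2 * pi * frac (x $ j / (2 * pi)) \<le> 2 * pi * 1"
      using frac_lt_1[of "x $ j / (2 * pi)"] by (intro mult_left_mono) auto
    ultimately show ?thesis by simp
  qed
  then have "x + s UNIV \<in> period_box"
    by (simp add: mem_box_cart)
  then show ?thesis using per that by blast
qed

lemma torus_smooth_bounded:
  fixes F :: "real^'n::finite \<Rightarrow> complex"
  assumes "F \<in> torus_smooth"
  obtains B where "\<And>x. norm (F x) \<le> B"
proof -
  have "compact (F ` period_box)"
    by (intro compact_continuous_image torus_smooth_continuous_on assms compact_cbox)
  then obtain B where B: "\<And>z. z \<in> F ` period_box \<Longrightarrow> norm z \<le> B"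
    using compact_imp_bounded bounded_iff by metis
  have "norm (F x) \<le> B" for x
    using period_box_representative[of x] B assms by (metis image_eqI)
  then show ?thesis using that by blast
qed

section \<open>Fourier modes\<close>

definition mode :: "int^'n::finite \<Rightarrow> real^'n \<Rightarrow> complex" where
  "mode \<xi> x = exp (\<i> * of_real (x \<bullet> real_freq \<xi>))"

lemma real_freq_component [simp]: "real_freq \<xi> $ j = real_of_int (\<xi> $ j)"
  by (simp add: real_freq_def)

lemma real_freq_uminus: "real_freq (- \<xi>) = - real_freq \<xi>"
  by (simp add: vec_eq_iff)

lemma real_freq_add: "real_freq (\<xi> + \<eta>) = real_freq \<xi> + real_freq \<eta>"
  by (simp add: vec_eq_iff)

lemma fourier_eq: "fourier u \<xi> = u (mode (- \<xi>))"
proof -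
  have "(\<lambda>x. exp (- \<i> * of_real (x \<bullet> real_freq \<xi>))) = mode (- \<xi>)"
    by (auto simp: mode_def real_freq_uminus)
  then show ?thesis by (simp add: fourier_def)
qed

lemma norm_mode [simp]: "norm (mode \<xi> x) = 1"
  by (simp add: mode_def)

lemma mode_mult: "mode \<xi> x * mode \<eta> x = mode (\<xi> + \<eta>) x"
  by (simp add: mode_def real_freq_add inner_add_right exp_add algebra_simps)

lemma mode_has_derivative:
  "(mode \<xi> has_derivative (\<lambda>h. \<i> * of_real (h \<bullet> real_freq \<xi>) * mode \<xi> x)) (at x)"
proof -
  have "((\<lambda>x. exp (\<i> * of_real (x \<bullet> real_freq \<xi>))) has_derivative
      (\<lambda>h. exp (\<i> * of_real (x \<bullet> real_freq \<xi>)) * (\<i> * of_real (h \<bullet> real_freq \<xi>)))) (at x)"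
  proof -
    have "((\<lambda>x. \<i> * complex_of_real (x \<bullet> real_freq \<xi>)) has_derivative
        (\<lambda>h. \<i> * of_real (h \<bullet> real_freq \<xi>))) (at x)"
      by (intro derivative_intros has_derivative_of_real has_derivative_inner_left)
    from has_derivative_compose[OF this DERIV_exp[unfolded has_field_derivative_def]]
    show ?thesis .
  qed
  then show ?thesis
    by (simp add: mode_def[abs_def] mult.commute)
qed

lemma dir_deriv_mode: "dir_deriv b (mode \<xi>) = (\<lambda>x. \<i> * of_real (b \<bullet> real_freq \<xi>) * mode \<xi> x)"
  using dir_deriv_eq[OF mode_has_derivative] by blast

text \<open>The scalar multiples of one exponential are closed under differentiation.\<close>

lemma smooth_mode: "smooth (mode \<xi>)"
proof -
  have "\<exists>c. mode \<xi> = (\<lambda>x. c * mode \<xi> x)"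
    by (rule exI[of _ 1]) simp
  then show ?thesis
  proof (rule smooth_coinduct[where P = "\<lambda>f. \<exists>c. f = (\<lambda>x. c * mode \<xi> x)"])
    fix f assume "\<exists>c. f = (\<lambda>x. c * mode \<xi> x)"
    then obtain c where f: "f = (\<lambda>x. c * mode \<xi> x)" by blast
    have d: "(f has_derivative (\<lambda>h. c * (\<i> * of_real (h \<bullet> real_freq \<xi>) * mode \<xi> x))) (at x)" for x
      unfolding f by (rule has_derivative_mult_right[OF mode_has_derivative])
    have "dir_deriv b f = (\<lambda>x. (c * \<i> * of_real (b \<bullet> real_freq \<xi>)) * mode \<xi> x)" for b
      using dir_deriv_eq[OF d] by (simp add: fun_eq_iff mult.assoc)
    then show "f differentiable_on UNIV \<and> (\<forall>b\<in>Basis. \<exists>c. dir_deriv b f = (\<lambda>x. c * mode \<xi> x))"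
      using d by (auto simp: differentiable_on_def differentiable_def)
  qed
qed

lemma mode_shift: "mode \<xi> (x + axis j s) = exp (\<i> * of_real (s * real_of_int (\<xi> $ j))) * mode \<xi> x"
proof -
  have "axis j s \<bullet> real_freq \<xi> = s * real_of_int (\<xi> $ j)"
    by (simp add: inner_axis_axis inner_axis')
  then show ?thesis
    by (simp add: mode_def inner_add_left exp_add algebra_simps)
qed

lemma mode_torus_smooth: "mode \<xi> \<in> torus_smooth"
proof -
  have "exp (\<i> * of_real (2 * pi * real_of_int m)) = 1" for m
    by (metis exp_plus_2pin mult.commute mult.left_commute of_real_mult of_real_numeral
        of_real_of_int_eq add_0 exp_zero mult.assoc)
  then show ?thesis
    unfolding torus_smooth_def using smooth_mode[of \<xi>] by (auto simp: mode_shift)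
qed

lemma D_x_cmult_mode: "D_x j (\<lambda>x. c * mode \<xi> x) = (\<lambda>x. of_int (\<xi> $ j) * c * mode \<xi> x)"
proof -
  have "axis j 1 \<bullet> real_freq \<xi> = real_of_int (\<xi> $ j)"
    by (simp add: inner_axis_axis inner_axis')
  then show ?thesis
    by (auto simp: D_x_def dir_deriv_cmult smooth_mode dir_deriv_mode fun_eq_iff algebra_simps)
qed

lemma D_x_funpow_cmult_mode:
  "(D_x j ^^ n) (\<lambda>x. c * mode \<xi> x) = (\<lambda>x. of_int (\<xi> $ j) ^ n * c * mode \<xi> x)"
  by (induction n) (simp_all add: D_x_cmult_mode, simp add: mult.assoc)

lemma coord_list: "distinct (coord_list :: 'n::finite list)" "set (coord_list :: 'n list) = UNIV"
proof -
  have "\<exists>js :: 'n list. distinct js \<and> set js = UNIV"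
    using finite_distinct_list[of "UNIV :: 'n set"] by auto
  then have "distinct (coord_list :: 'n list) \<and> set (coord_list :: 'n list) = UNIV"
    unfolding coord_list_def by (rule someI_ex)
  then show "distinct (coord_list :: 'n list)" "set (coord_list :: 'n list) = UNIV" by auto
qed

lemma D_multi_cmult_mode:
  "D_multi \<alpha> (\<lambda>x. c * mode \<xi> x) = (\<lambda>x. (\<Prod>j\<in>UNIV. of_int (\<xi> $ j) ^ \<alpha> j) * c * mode \<xi> x)"
proof -
  have "foldr (\<lambda>j. D_x j ^^ \<alpha> j) js (\<lambda>x. c * mode \<xi> x)
      = (\<lambda>x. (\<Prod>j\<leftarrow>js. of_int (\<xi> $ j) ^ \<alpha> j) * c * mode \<xi> x)" for js
    by (induction js) (simp_all add: D_x_funpow_cmult_mode, simp add: mult.assoc)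
  moreover have "(\<Prod>j\<leftarrow>coord_list. f j) = (\<Prod>j\<in>UNIV. f j)" for f :: "'a \<Rightarrow> complex"
    using coord_list by (metis prod.distinct_set_conv_list)
  ultimately show ?thesis by (simp add: D_multi_def)
qed

lemma D_multi_0: "D_multi (\<lambda>_. 0) F = F"
proof -
  have "foldr (\<lambda>j. D_x j ^^ 0) js F = F" for js
    by (induction js) auto
  then show ?thesis by (simp add: D_multi_def)
qed

lemma norm_D_multi_cmult_mode_le:
  assumes "\<And>j. \<bar>real_of_int (\<xi> $ j)\<bar> \<le> R"
  shows "norm (D_multi \<alpha> (\<lambda>x. c * mode \<xi> x) x) \<le> norm c * R ^ mlength \<alpha>"
proof -
  have "(\<Prod>j\<in>UNIV. norm (of_int (\<xi> $ j) ^ \<alpha> j :: complex)) \<le> (\<Prod>j\<in>UNIV. R ^ \<alpha> j)"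
    using assms by (intro prod_mono) (auto simp: norm_power power_mono)
  also have "\<dots> = R ^ mlength \<alpha>"
    by (simp add: mlength_def power_sum)
  finally show ?thesis
    by (simp add: D_multi_cmult_mode norm_mult prod_norm[symmetric] mult.commute mult_left_mono)
qed

text \<open>The shifted box and the period box share the middle part \<open>cbox c P\<close>. The
  slab that the first gains at the far end is the slab it loses at the near end, moved by one
  period. Both boxes are cut by a hyperplane in the single coordinate \<open>j\<close>.\<close>

lemma integral_period_box_shift:
  fixes F :: "real^'n::finite \<Rightarrow> complex"
  assumes F: "F \<in> torus_smooth" and s: "0 \<le> s" "s \<le> 2 * pi"
  shows "integral period_box (\<lambda>x. F (x + axis j s)) = integral period_box F"
proof -
  define c p P :: "real^'n" where "c = axis j s" and "p = axis j (2 * pi)" and "P = (\<chi> j. 2 * pi)"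
  have cont: "continuous_on A F" for A using F by (rule torus_smooth_continuous_on)
  have has: "(F has_integral integral (cbox a b) F) (cbox a b)" for a b
    using integrable_continuous[OF cont] by blast
  have inner: "x \<bullet> axis j 1 = x $ j" for x :: "real^'n"
    by (simp add: inner_axis)
  have comps: "c $ j = s" "p $ j = 2 * pi" "P $ j = 2 * pi"
    "\<And>i. i \<noteq> j \<Longrightarrow> c $ i = 0" "\<And>i. i \<noteq> j \<Longrightarrow> p $ i = 0" "\<And>i. P $ i = 2 * pi"
    by (auto simp: c_def p_def P_def axis_def)
  have box: "x \<in> cbox a b \<longleftrightarrow> (a $ j \<le> x $ j \<and> x $ j \<le> b $ j) \<and> (\<forall>i. i \<noteq> j \<longrightarrow> a $ i \<le> x $ i \<and> x $ i \<le> b $ i)"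
    for x a b :: "real^'n"
    unfolding mem_box_cart by metis
  have split1: "cbox 0 P \<inter> {x. x \<bullet> axis j 1 \<le> s} = cbox 0 (P + c - p)"
    and split1': "cbox 0 P \<inter> {x. x \<bullet> axis j 1 \<ge> s} = cbox c P"
    and split2: "cbox c (P + c) \<inter> {x. x \<bullet> axis j 1 \<le> 2 * pi} = cbox c P"
    and split2': "cbox c (P + c) \<inter> {x. x \<bullet> axis j 1 \<ge> 2 * pi} = cbox p (P + c)"
    unfolding inner set_eq_iff Int_iff mem_Collect_eq box using s by (auto simp: comps)
  have 1: "integral (cbox 0 P) F = integral (cbox 0 (P + c - p)) F + integral (cbox c P) F"
    by (rule integral_unique, rule has_integral_split[where k = "axis j 1" and c = s])
      (auto simp: split1 split1' has axis_in_Basis)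
  have 2: "integral (cbox c (P + c)) F = integral (cbox c P) F + integral (cbox p (P + c)) F"
    by (rule integral_unique, rule has_integral_split[where k = "axis j 1" and c = "2 * pi"])
      (auto simp: split2 split2' has axis_in_Basis)
  have "integral (cbox p (P + c)) F = integral (cbox 0 (P + c - p)) (\<lambda>x. F (x + p))"
    using integral_shift_cbox[of p p "P + c" F] by simp
  also have "\<dots> = integral (cbox 0 (P + c - p)) F"
    using torus_smooth_periodic[OF F] by (simp add: p_def)
  finally have "integral (cbox c (P + c)) F = integral (cbox 0 P) F"
    using 1 2 by simp
  then show ?thesis
    using integral_shift_cbox[of c c "P + c" F] by (simp add: c_def P_def)
qed

text \<open>In a coordinate with nonzero frequency, a shift by half a wavelength changes the sign of
  the mode but preserves the integral, which is therefore zero. The frequency is an integer, so this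
  shift is shorter than a period.\<close>

lemma integral_mode: "integral period_box (mode \<xi>) = (if \<xi> = 0 then of_real ((2 * pi) ^ CARD('n)) else 0)"
  for \<xi> :: "int^'n::finite"
proof (cases "\<xi> = 0")
  case True
  then have "mode \<xi> = (\<lambda>x. 1)"
    by (auto simp: mode_def real_freq_def zero_vec_def[symmetric])
  moreover have "measure lborel (period_box :: (real^'n) set) = (2 * pi) ^ CARD('n)"
    by (subst content_cbox_cart) (auto simp: interval_ne_empty_cart)
  ultimately show ?thesis using True
    by (simp add: scaleR_conv_of_real)
next
  case False
  then obtain j where j: "\<xi> $ j \<noteq> 0" by (auto simp: vec_eq_iff)
  define s where "s = pi / \<bar>real_of_int (\<xi> $ j)\<bar>"
  have "1 \<le> \<bar>real_of_int (\<xi> $ j)\<bar>" using j by linarith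
  then have s: "0 \<le> s" "s \<le> 2 * pi"
    using j by (auto simp: s_def field_simps)
  have "s * real_of_int (\<xi> $ j) = pi \<or> s * real_of_int (\<xi> $ j) = - pi"
    using j by (auto simp: s_def abs_if)
  then have "exp (\<i> * of_real (s * real_of_int (\<xi> $ j))) = -1"
    by (auto simp: exp_minus exp_pi_i exp_pi_i' simp del: of_real_mult)
  then have "integral period_box (\<lambda>x. - mode \<xi> x) = integral period_box (mode \<xi>)"
    using integral_period_box_shift[OF mode_torus_smooth s, of \<xi> j] by (simp add: mode_shift)
  then show ?thesis using False by simp
qed

section \<open>Distributions\<close>

lemma finite_multi_indices: "finite {\<alpha> :: 'n::finite \<Rightarrow> nat. mlength \<alpha> \<le> m}"
proof (rule finite_subset)
  show "{\<alpha> :: 'n \<Rightarrow> nat. mlength \<alpha> \<le> m} \<subseteq> PiE UNIV (\<lambda>_. {..m})"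
  proof
    fix \<alpha> :: "'n \<Rightarrow> nat" assume "\<alpha> \<in> {\<alpha>. mlength \<alpha> \<le> m}"
    moreover have "\<alpha> j \<le> mlength \<alpha>" for j
      unfolding mlength_def by (rule member_le_sum) auto
    ultimately show "\<alpha> \<in> PiE UNIV (\<lambda>_. {..m})"
      using order_trans by fastforce
  qed
qed (auto intro: finite_PiE)

definition derivative_sup :: "nat \<Rightarrow> (real^'n::finite \<Rightarrow> complex) \<Rightarrow> real" where
  "derivative_sup m \<phi> = (SUP (\<alpha>, x) \<in> {\<alpha>. mlength \<alpha> \<le> m} \<times> UNIV. norm (D_multi \<alpha> \<phi> x))"

text \<open>A real supremum is meaningful for bounded sets only. Here there are finitely many
  multi-indices, and each derivative is bounded by periodicity.\<close>

lemma bdd_above_derivatives: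
  assumes "\<phi> \<in> torus_smooth"
  shows "bdd_above ((\<lambda>(\<alpha>, x). norm (D_multi \<alpha> \<phi> x)) ` ({\<alpha>. mlength \<alpha> \<le> m} \<times> UNIV))"
proof -
  have "\<exists>B. \<forall>x. norm (D_multi \<alpha> \<phi> x) \<le> B" for \<alpha>
    using torus_smooth_bounded[OF torus_smooth_D_multi[OF assms]] by metis
  then have "bdd_above (\<Union>\<alpha>\<in>{\<alpha>. mlength \<alpha> \<le> m}. range (\<lambda>x. norm (D_multi \<alpha> \<phi> x)))"
    by (subst bdd_above_UN[OF finite_multi_indices]) (auto simp: bdd_above_def)
  then show ?thesis
    by (rule back_subst[where P = bdd_above]) auto
qed

lemma norm_le_derivative_sup:
  assumes "\<phi> \<in> torus_smooth" "mlength \<alpha> \<le> m"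
  shows "norm (D_multi \<alpha> \<phi> x) \<le> derivative_sup m \<phi>"
  unfolding derivative_sup_def
  using cSUP_upper[OF _ bdd_above_derivatives[OF assms(1)], of "(\<alpha>, x)" m] assms(2) by simp

lemma norm_le_derivative_sup_0: "\<phi> \<in> torus_smooth \<Longrightarrow> norm (\<phi> x) \<le> derivative_sup m \<phi>"
  using norm_le_derivative_sup[of \<phi> "\<lambda>_. 0" m x] by (simp add: D_multi_0 mlength_def)

lemma derivative_sup_nonneg: "\<phi> \<in> torus_smooth \<Longrightarrow> 0 \<le> derivative_sup m \<phi>"
  using norm_le_derivative_sup_0[of \<phi> 0 m] norm_ge_zero order_trans by blast

lemma derivative_sup_mono:
  assumes "\<phi> \<in> torus_smooth" "m \<le> m'"
  shows "derivative_sup m \<phi> \<le> derivative_sup m' \<phi>"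
proof -
  have "mlength (\<lambda>_. 0) \<le> m" by (simp add: mlength_def)
  then show ?thesis
    unfolding derivative_sup_def
    by (intro cSUP_subset_mono bdd_above_derivatives) (use assms in auto)
qed

lemma distributions_iff: "u \<in> distributions \<longleftrightarrow>
     (\<forall>\<phi>. \<phi> \<notin> torus_smooth \<longrightarrow> u \<phi> = 0) \<and>
     (\<forall>\<phi>\<in>torus_smooth. \<forall>\<psi>\<in>torus_smooth. u (\<lambda>x. \<phi> x + \<psi> x) = u \<phi> + u \<psi>) \<and>
     (\<forall>\<phi>\<in>torus_smooth. \<forall>c. u (\<lambda>x. c * \<phi> x) = c * u \<phi>) \<and>
     (\<exists>C m. \<forall>\<phi>\<in>torus_smooth. norm (u \<phi>) \<le> C * derivative_sup m \<phi>)"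
  unfolding distributions_def derivative_sup_def by blast

lemma distributions_cmult:
  "u \<in> distributions \<Longrightarrow> \<phi> \<in> torus_smooth \<Longrightarrow> u (\<lambda>x. c * \<phi> x) = c * u \<phi>"
  by (simp add: distributions_iff)

text \<open>A nonnegative constant and a bound for all larger orders allow the estimates of two
  distributions to be added at a common order.\<close>

lemma distributions_bound:
  assumes "u \<in> distributions"
  obtains C m where "0 \<le> C" "\<And>\<phi> m'. \<phi> \<in> torus_smooth \<Longrightarrow> m \<le> m' \<Longrightarrow> norm (u \<phi>) \<le> C * derivative_sup m' \<phi>"
proof -
  obtain C m where C: "\<And>\<phi>. \<phi> \<in> torus_smooth \<Longrightarrow> norm (u \<phi>) \<le> C * derivative_sup m \<phi>"
    using assms unfolding distributions_iff by blast
  have "norm (u \<phi>) \<le> \<bar>C\<bar> * derivative_sup m' \<phi>" if "\<phi> \<in> torus_smooth" "m \<le> m'" for \<phi> m'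
  proof -
    have "C * derivative_sup m \<phi> \<le> \<bar>C\<bar> * derivative_sup m' \<phi>"
      using that by (intro mult_mono derivative_sup_mono derivative_sup_nonneg) auto
    then show ?thesis using C[OF that(1)] by linarith
  qed
  then show ?thesis using that[of "\<bar>C\<bar>" m] by simp
qed

lemma distributions_combination:
  assumes "u \<in> distributions" "v \<in> distributions"
  shows "(\<lambda>\<phi>. a * u \<phi> + b * v \<phi>) \<in> distributions"
proof -
  obtain C m where C: "0 \<le> C" "\<And>\<phi> m'. \<phi> \<in> torus_smooth \<Longrightarrow> m \<le> m' \<Longrightarrow> norm (u \<phi>) \<le> C * derivative_sup m' \<phi>"
    using assms distributions_bound by metis
  obtain C' k where C': "0 \<le> C'" "\<And>\<phi> m'. \<phi> \<in> torus_smooth \<Longrightarrow> k \<le> m' \<Longrightarrow> norm (v \<phi>) \<le> C' * derivative_sup m' \<phi>"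
    using assms distributions_bound by metis
  have "norm (a * u \<phi> + b * v \<phi>) \<le> (norm a * C + norm b * C') * derivative_sup (max m k) \<phi>"
    if "\<phi> \<in> torus_smooth" for \<phi>
  proof -
    have "norm (a * u \<phi> + b * v \<phi>) \<le> norm a * norm (u \<phi>) + norm b * norm (v \<phi>)"
      by (metis norm_mult norm_triangle_ineq)
    also have "\<dots> \<le> norm a * (C * derivative_sup (max m k) \<phi>) + norm b * (C' * derivative_sup (max m k) \<phi>)"
      using C(2)[OF that, of "max m k"] C'(2)[OF that, of "max m k"]
      by (intro add_mono mult_left_mono) auto
    finally show ?thesis by (simp add: algebra_simps)
  qed
  then have "\<exists>C m. \<forall>\<phi>\<in>torus_smooth. norm (a * u \<phi> + b * v \<phi>) \<le> C * derivative_sup m \<phi>"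
    by blast
  then show ?thesis
    using assms unfolding distributions_iff by (simp add: algebra_simps)
qed

section \<open>Smooth functions as distributions\<close>

lemma integrable_torus_smooth:
  assumes "F \<in> torus_smooth" "\<phi> \<in> torus_smooth"
  shows "(\<lambda>x. F x * \<phi> x) integrable_on period_box"
  by (intro integrable_continuous continuous_intros torus_smooth_continuous_on assms)

lemma dist_of_combination:
  fixes F G :: "real^'n::finite \<Rightarrow> complex"
  assumes "F \<in> torus_smooth" "G \<in> torus_smooth"
  shows "dist_of (\<lambda>x. a * F x + b * G x) = (\<lambda>\<phi>. a * dist_of F \<phi> + b * dist_of G \<phi>)"
proof
  fix \<phi> :: "real^'n \<Rightarrow> complex"
  show "dist_of (\<lambda>x. a * F x + b * G x) \<phi> = a * dist_of F \<phi> + b * dist_of G \<phi>"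
  proof (cases "\<phi> \<in> torus_smooth")
    case True
    note i = integrable_torus_smooth[OF assms(1) True] integrable_torus_smooth[OF assms(2) True]
    have "integral period_box (\<lambda>x. (a * F x + b * G x) * \<phi> x)
        = integral period_box (\<lambda>x. a * (F x * \<phi> x) + b * (G x * \<phi> x))"
      by (simp add: algebra_simps)
    also have "\<dots> = a * integral period_box (\<lambda>x. F x * \<phi> x) + b * integral period_box (\<lambda>x. G x * \<phi> x)"
      using i by (subst Henstock_Kurzweil_Integration.integral_add)
        (auto intro: integrable_on_mult_right)
    finally show ?thesis using True by (simp add: dist_of_def add_divide_distrib)
  qed (simp add: dist_of_def)
qed

lemma dist_of_distribution:
  fixes F :: "real^'n::finite \<Rightarrow> complex"
  assumes F: "F \<in> torus_smooth"
  shows "dist_of F \<in> distributions"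
proof -
  obtain B where B: "\<And>x. norm (F x) \<le> B" using torus_smooth_bounded[OF F] by blast
  then have B0: "0 \<le> B" using norm_ge_zero order_trans by blast
  define V :: real where "V = measure lborel (period_box :: (real^'n) set) / (2 * pi) ^ CARD('n)"
  have "norm (dist_of F \<phi>) \<le> (B * V) * derivative_sup 0 \<phi>" if \<phi>: "\<phi> \<in> torus_smooth" for \<phi>
  proof -
    have "norm (integral period_box (\<lambda>x. F x * \<phi> x))
        \<le> (B * derivative_sup 0 \<phi>) * measure lborel (period_box :: (real^'n) set)"
      using integrable_torus_smooth[OF F \<phi>] B0 B norm_le_derivative_sup_0[OF \<phi>] derivative_sup_nonneg[OF \<phi>]
      by (intro has_integral_bound[OF _ integrable_integral])
        (auto simp: norm_mult intro!: mult_mono)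
    then have "norm (integral period_box (\<lambda>x. F x * \<phi> x)) / (2 * pi) ^ CARD('n)
        \<le> (B * derivative_sup 0 \<phi>) * measure lborel (period_box :: (real^'n) set) / (2 * pi) ^ CARD('n)"
      by (rule divide_right_mono) simp
    moreover have "norm (complex_of_real ((2 * pi) ^ CARD('n))) = (2 * pi) ^ CARD('n)"
      unfolding norm_of_real by simp
    ultimately show ?thesis
      using \<phi> by (simp only: dist_of_def if_True norm_divide V_def) (simp add: mult_ac)
  qed
  moreover have "dist_of F (\<lambda>x. \<phi> x + \<psi> x) = dist_of F \<phi> + dist_of F \<psi>"
    if "\<phi> \<in> torus_smooth" "\<psi> \<in> torus_smooth" for \<phi> \<psi>
    using that torus_smooth_combination[OF that, of 1 1] integrable_torus_smooth[OF F]
    by (simp add: dist_of_def ring_distribs Henstock_Kurzweil_Integration.integral_add add_divide_distrib)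
  moreover have "dist_of F (\<lambda>x. c * \<phi> x) = c * dist_of F \<phi>" if "\<phi> \<in> torus_smooth" for c \<phi>
    using that torus_smooth_cmult[OF that, of c]
    by (simp add: dist_of_def mult.left_commute[of _ c])
  ultimately show ?thesis
    unfolding distributions_iff by (auto simp: dist_of_def)
qed

lemma torus_smooth_cnj: "F \<in> torus_smooth \<Longrightarrow> (\<lambda>x. cnj (F x)) \<in> torus_smooth"
  by (simp add: torus_smooth_def smooth_bounded_linear[OF _ bounded_linear_cnj])

text \<open>Testing with the conjugate of \<open>F\<close> makes the integral of the continuous
  function \<open>(norm (F x))\<^sup>2\<close> over a period box vanish, hence the function
  itself.\<close>

lemma dist_of_eq_0:
  fixes F :: "real^'n::finite \<Rightarrow> complex"
  assumes F: "F \<in> torus_smooth" and 0: "dist_of F = (\<lambda>_. 0)"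
  shows "F x = 0"
proof -
  have "integral period_box (\<lambda>x. F x * cnj (F x)) = 0"
    using fun_cong[OF 0, of "\<lambda>x. cnj (F x)"] torus_smooth_cnj[OF F] by (simp add: dist_of_def)
  then have "((\<lambda>x. F x * cnj (F x)) has_integral 0) period_box"
    using integrable_integral[OF integrable_torus_smooth[OF F torus_smooth_cnj[OF F]]] by simp
  then have "((\<lambda>x. complex_of_real ((norm (F x))\<^sup>2)) has_integral 0) period_box"
    by (simp only: complex_norm_square)
  from has_integral_linear[OF this bounded_linear_Re]
  have *: "((\<lambda>x. (norm (F x))\<^sup>2) has_integral 0) period_box" by (simp add: o_def)
  obtain y where y: "y \<in> period_box" "F y = F x"
    using period_box_representative[of x] F by metis
  have "(norm (F y))\<^sup>2 = 0"
  proof (rule has_integral_0_cbox_imp_0[OF _ _ * _ y(1)])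
    show "continuous_on period_box (\<lambda>x. (norm (F x))\<^sup>2)"
      by (intro continuous_intros torus_smooth_continuous_on F)
    show "box 0 (\<chi> j. 2 * pi) \<noteq> ({} :: (real^'n) set)"
      by (simp add: interval_ne_empty_cart)
  qed simp
  then show ?thesis using y by simp
qed

text \<open>This uniqueness is what gives the definite description in \<open>fun_of\<close> its
  intended value.\<close>

lemma dist_of_inj:
  assumes "F \<in> torus_smooth" "G \<in> torus_smooth" "dist_of F = dist_of G"
  shows "F = G"
proof
  fix x
  have "dist_of (\<lambda>x. 1 * F x + (-1) * G x) = (\<lambda>_. 0)"
    unfolding dist_of_combination[OF assms(1,2)] assms(3) by simp
  from dist_of_eq_0[OF torus_smooth_combination[OF assms(1,2)] this, of x]
  show "F x = G x" by simp
qed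

lemma fun_of_dist_of: "F \<in> torus_smooth \<Longrightarrow> fun_of (dist_of F) = F"
  unfolding fun_of_def using dist_of_inj by (intro the_equality) auto

text \<open>The distributions on which \<open>fun_of\<close> is meaningful.\<close>

definition regular :: "'n::finite functional set" where
  "regular = dist_of ` torus_smooth"

lemma regular_iff: "u \<in> regular \<longleftrightarrow> (\<exists>F. F \<in> torus_smooth \<and> dist_of F = u)"
  by (auto simp: regular_def)

lemma fun_of_regular:
  assumes "u \<in> regular"
  shows "fun_of u \<in> torus_smooth" "dist_of (fun_of u) = u"
  using assms by (auto simp: regular_def fun_of_dist_of)

lemma regular_combination:
  assumes "u \<in> regular" "v \<in> regular"
  shows "(\<lambda>\<phi>. a * u \<phi> + b * v \<phi>) \<in> regular"
    and "fun_of (\<lambda>\<phi>. a * u \<phi> + b * v \<phi>) = (\<lambda>x. a * fun_of u x + b * fun_of v x)"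
proof -
  let ?F = "\<lambda>x. a * fun_of u x + b * fun_of v x"
  have 1: "dist_of ?F = (\<lambda>\<phi>. a * u \<phi> + b * v \<phi>)"
    unfolding dist_of_combination[OF fun_of_regular(1)[OF assms(1)] fun_of_regular(1)[OF assms(2)]]
      fun_of_regular(2)[OF assms(1)] fun_of_regular(2)[OF assms(2)] ..
  have 2: "?F \<in> torus_smooth"
    using assms by (intro torus_smooth_combination fun_of_regular)
  show "(\<lambda>\<phi>. a * u \<phi> + b * v \<phi>) \<in> regular"
    unfolding regular_iff using 1 2 by (intro exI conjI)
  show "fun_of (\<lambda>\<phi>. a * u \<phi> + b * v \<phi>) = ?F"
    using fun_of_dist_of[OF 2] unfolding 1 .
qed

text \<open>A distribution \<open>u\<close> that is not given by a smooth function has the junk value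
  \<open>fun_of u = (THE F. False)\<close>, and subtracting \<open>u\<close> from a regular distribution keeps that value.
  Hence the regularity theorem for \<open>C_infty\<close> is not needed below.\<close>

lemma fun_of_diff_irregular:
  assumes "v \<in> regular" "u \<notin> regular"
  shows "fun_of (\<lambda>\<phi>. v \<phi> - u \<phi>) = fun_of u"
proof -
  have "(\<lambda>\<phi>. v \<phi> - u \<phi>) \<notin> regular"
  proof
    assume "(\<lambda>\<phi>. v \<phi> - u \<phi>) \<in> regular"
    from regular_combination(1)[OF assms(1) this, of 1 "-1"] have "(\<lambda>\<phi>. u \<phi>) \<in> regular" by simp
    then show False using assms(2) by simp
  qed
  then have "\<not> (F \<in> torus_smooth \<and> dist_of F = (\<lambda>\<phi>. v \<phi> - u \<phi>))" for F
    unfolding regular_iff not_ex by (rule spec)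
  moreover have "\<not> (F \<in> torus_smooth \<and> dist_of F = u)" for F
    using assms(2) unfolding regular_iff not_ex by (rule spec)
  ultimately show ?thesis by (simp only: fun_of_def)
qed

lemma dist_of_mode: "dist_of (mode \<xi>) (mode \<eta>) = (if \<xi> + \<eta> = 0 then 1 else 0)"
proof -
  have "(\<lambda>x. mode \<xi> x * mode \<eta> x) = mode (\<xi> + \<eta>)" by (simp add: mode_mult)
  then show ?thesis
    using mode_torus_smooth[of \<eta>] by (simp add: dist_of_def integral_mode)
qed

lemma fourier_dist_of_mode: "fourier (dist_of (mode \<xi>)) \<eta> = (if \<eta> = \<xi> then 1 else 0)"
  by (auto simp: fourier_eq dist_of_mode)

section \<open>Sobolev spaces\<close>

text \<open>The exponent is \<open>r\<close> and not \<open>2 * r\<close>: the weight stands inside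
  the square, so that finite partial sums of the norm are values of \<open>L2_set\<close> and obey
  its triangle inequality.\<close>

definition sobolev_weight :: "real \<Rightarrow> int^'n::finite \<Rightarrow> real" where
  "sobolev_weight r \<xi> = (1 + norm (real_freq \<xi>)) powr r"

lemma sobolev_weight_pos: "0 < sobolev_weight r \<xi>"
  using norm_ge_zero[of "real_freq \<xi>"] unfolding sobolev_weight_def powr_gt_zero by linarith

lemma sobolev_summand:
  "(norm z)\<^sup>2 * (1 + norm (real_freq \<xi>)) powr (2 * r) = (norm z * sobolev_weight r \<xi>)\<^sup>2"
  by (simp add: sobolev_weight_def power_mult_distrib power2_eq_square powr_add[symmetric])

lemma sobolev_iff: "u \<in> sobolev r \<longleftrightarrow> u \<in> distributions \<and>
    (\<lambda>\<xi>. (norm (fourier u \<xi>) * sobolev_weight r \<xi>)\<^sup>2) summable_on UNIV"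
  by (simp add: sobolev_def sobolev_summand)

lemma sobolev_norm_eq:
  "sobolev_norm r u = sqrt (\<Sum>\<^sub>\<infinity>\<xi>. (norm (fourier u \<xi>) * sobolev_weight r \<xi>)\<^sup>2)"
  by (simp add: sobolev_norm_def sobolev_summand)

lemma L2_set_le_sobolev_norm:
  assumes "u \<in> sobolev r" "finite A"
  shows "L2_set (\<lambda>\<xi>. norm (fourier u \<xi>) * sobolev_weight r \<xi>) A \<le> sobolev_norm r u"
  unfolding L2_set_def sobolev_norm_eq
  using assms by (intro real_sqrt_le_mono finite_sum_le_infsum) (auto simp: sobolev_iff)

lemma norm_fourier_le_sobolev_norm:
  assumes "u \<in> sobolev r"
  shows "norm (fourier u \<xi>) * sobolev_weight r \<xi> \<le> sobolev_norm r u"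
  using L2_set_le_sobolev_norm[OF assms, of "{\<xi>}"] sobolev_weight_pos[of r \<xi>] by simp

text \<open>A bound on all finite partial norms yields summability and the bound on the norm at
  once. Infinite sums are thereby avoided in the estimates that follow.\<close>

lemma sobolevI:
  assumes "u \<in> distributions"
    and "\<And>A. finite A \<Longrightarrow> L2_set (\<lambda>\<xi>. norm (fourier u \<xi>) * sobolev_weight r \<xi>) A \<le> B"
  shows "u \<in> sobolev r" "sobolev_norm r u \<le> B"
proof -
  let ?f = "\<lambda>\<xi>. (norm (fourier u \<xi>) * sobolev_weight r \<xi>)\<^sup>2"
  have B: "0 \<le> B" using assms(2)[of "{}"] by simp
  have le: "sum ?f A \<le> B\<^sup>2" if "finite A" for A
  proof -
    have "(L2_set (\<lambda>\<xi>. norm (fourier u \<xi>) * sobolev_weight r \<xi>) A)\<^sup>2 \<le> B\<^sup>2"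
      using assms(2)[OF that] by (intro power_mono) auto
    then show ?thesis by (simp add: L2_set_def sum_nonneg)
  qed
  then have s: "?f summable_on UNIV"
    using le by (intro nonneg_bdd_above_summable_on bdd_aboveI[where M = "B\<^sup>2"]) auto
  then show "u \<in> sobolev r" using assms(1) by (simp add: sobolev_iff)
  have "infsum ?f UNIV \<le> B\<^sup>2"
    using s le by (intro infsum_le_finite_sums) auto
  then have "sobolev_norm r u \<le> sqrt (B\<^sup>2)"
    unfolding sobolev_norm_eq by (rule real_sqrt_le_mono)
  then show "sobolev_norm r u \<le> B" using B by simp
qed

lemma sobolev_combination:
  assumes "u \<in> sobolev r" "v \<in> sobolev r"
  shows "(\<lambda>\<phi>. a * u \<phi> + b * v \<phi>) \<in> sobolev r"
    and "sobolev_norm r (\<lambda>\<phi>. a * u \<phi> + b * v \<phi>) \<le> norm a * sobolev_norm r u + norm b * sobolev_norm r v"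
proof -
  let ?w = "\<lambda>\<phi>. a * u \<phi> + b * v \<phi>"
  let ?c = "\<lambda>u \<xi>. norm (fourier u \<xi>) * sobolev_weight r \<xi>"
  have d: "?w \<in> distributions"
    using assms by (intro distributions_combination) (auto simp: sobolev_iff)
  have le: "L2_set (?c ?w) A \<le> norm a * sobolev_norm r u + norm b * sobolev_norm r v" if A: "finite A" for A
  proof -
    have "?c ?w \<xi> \<le> norm a * ?c u \<xi> + norm b * ?c v \<xi>" for \<xi>
    proof -
      have "norm (fourier ?w \<xi>) \<le> norm a * norm (fourier u \<xi>) + norm b * norm (fourier v \<xi>)"
        unfolding fourier_def by (rule norm_triangle_le) (simp add: norm_mult)
      then have "?c ?w \<xi> \<le> (norm a * norm (fourier u \<xi>) + norm b * norm (fourier v \<xi>)) * sobolev_weight r \<xi>"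
        using sobolev_weight_pos[of r \<xi>] by (intro mult_right_mono) auto
      then show ?thesis by (simp add: algebra_simps)
    qed
    then have "L2_set (?c ?w) A \<le> L2_set (\<lambda>\<xi>. norm a * ?c u \<xi> + norm b * ?c v \<xi>) A"
      by (intro L2_set_mono) (auto simp: less_imp_le[OF sobolev_weight_pos])
    also have "\<dots> \<le> L2_set (\<lambda>\<xi>. norm a * ?c u \<xi>) A + L2_set (\<lambda>\<xi>. norm b * ?c v \<xi>) A"
      by (rule L2_set_triangle_ineq)
    also have "\<dots> = norm a * L2_set (?c u) A + norm b * L2_set (?c v) A"
      by (simp add: L2_set_right_distrib)
    also have "\<dots> \<le> norm a * sobolev_norm r u + norm b * sobolev_norm r v"
      using assms A by (intro add_mono mult_left_mono L2_set_le_sobolev_norm) auto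
    finally show ?thesis .
  qed
  show "?w \<in> sobolev r" "sobolev_norm r ?w \<le> norm a * sobolev_norm r u + norm b * sobolev_norm r v"
    by (rule sobolevI[OF d], erule le)+
qed

lemma dist_of_mode_sobolev: "dist_of (mode \<xi>) \<in> sobolev r"
  and sobolev_norm_dist_of_mode: "sobolev_norm r (dist_of (mode \<xi>)) \<le> sobolev_weight r \<xi>"
proof -
  have le: "L2_set (\<lambda>\<eta>. norm (fourier (dist_of (mode \<xi>)) \<eta>) * sobolev_weight r \<eta>) A \<le> sobolev_weight r \<xi>"
    if "finite A" for A
  proof -
    have "L2_set (\<lambda>\<eta>. norm (fourier (dist_of (mode \<xi>)) \<eta>) * sobolev_weight r \<eta>) A
        \<le> (\<Sum>\<eta>\<in>A. norm (fourier (dist_of (mode \<xi>)) \<eta>) * sobolev_weight r \<eta>)"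
      \<comment> \<open>The l2 norm is at most the sum, in which only the frequency of the mode
        contributes.\<close>
      by (intro L2_set_le_sum) (simp add: less_imp_le[OF sobolev_weight_pos])
    also have "\<dots> = (\<Sum>\<eta>\<in>A. if \<eta> = \<xi> then sobolev_weight r \<xi> else 0)"
      by (intro sum.cong) (auto simp: fourier_dist_of_mode)
    also have "\<dots> \<le> sobolev_weight r \<xi>"
      using that sobolev_weight_pos[of r \<xi>] by simp
    finally show ?thesis .
  qed
  show "dist_of (mode \<xi>) \<in> sobolev r" "sobolev_norm r (dist_of (mode \<xi>)) \<le> sobolev_weight r \<xi>"
    by (rule sobolevI[OF dist_of_distribution[OF mode_torus_smooth]], erule le)+
qed

lemma C_infty_combination:
  "u \<in> C_infty \<Longrightarrow> v \<in> C_infty \<Longrightarrow> (\<lambda>\<phi>. a * u \<phi> + b * v \<phi>) \<in> C_infty"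
  by (auto simp: C_infty_def sobolev_combination)

lemma dist_of_mode_C_infty: "dist_of (mode \<xi>) \<in> C_infty"
  by (simp add: C_infty_def dist_of_mode_sobolev)

section \<open>Gevrey spaces\<close>

definition gevrey_weight :: "real \<Rightarrow> real \<Rightarrow> ('n::finite \<Rightarrow> nat) \<Rightarrow> real" where
  "gevrey_weight h s \<alpha> = h ^ mlength \<alpha> * fact (mlength \<alpha>) powr s"

lemma gevrey_weight_pos: "0 < h \<Longrightarrow> 0 < gevrey_weight h s \<alpha>"
  by (simp add: gevrey_weight_def)

text \<open>Moves Gevrey estimates from suprema in \<open>ennreal\<close> to inequalities between
  reals, uniform in the multi-index and the point.\<close>

lemma gevrey_norm_le_iff:
  assumes "0 < h" "0 \<le> C"
  shows "gevrey_norm h s u \<le> ennreal C \<longleftrightarrow>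
    (\<forall>\<alpha> x. norm (D_multi \<alpha> (fun_of u) x) \<le> C * gevrey_weight h s \<alpha>)"
proof -
  have "a / ennreal w \<le> ennreal C \<longleftrightarrow> a \<le> ennreal (C * w)" if "0 < w" for a w
  proof -
    have C: "ennreal (C * w) = ennreal C * ennreal w"
      using that assms by (simp add: ennreal_mult)
    have "a / ennreal w * ennreal w = a"
      using that by (simp add: ennreal_divide_times)
    then show ?thesis
      unfolding C using that divide_le_posI_ennreal[of "ennreal w" a "ennreal C"]
        mult_right_mono[of "a / ennreal w" "ennreal C" "ennreal w"]
      by (auto simp: mult.commute)
  qed
  then have "(SUP x. ennreal (norm (D_multi \<alpha> (fun_of u) x))) / ennreal (gevrey_weight h s \<alpha>) \<le> ennreal C
      \<longleftrightarrow> (\<forall>x. norm (D_multi \<alpha> (fun_of u) x) \<le> C * gevrey_weight h s \<alpha>)" for \<alpha>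
    using assms gevrey_weight_pos[OF assms(1), of s \<alpha>]
    by (simp add: SUP_le_iff less_imp_le)
  then show ?thesis
    unfolding gevrey_norm_def gevrey_weight_def[symmetric] SUP_le_iff by blast
qed

lemma gevrey_step_bound:
  assumes "u \<in> gevrey_step h s" "0 < h"
  shows "norm (D_multi \<alpha> (fun_of u) x) \<le> enn2real (gevrey_norm h s u) * gevrey_weight h s \<alpha>"
proof -
  have "gevrey_norm h s u \<le> ennreal (enn2real (gevrey_norm h s u))"
    using assms by (simp add: gevrey_step_def)
  then show ?thesis
    using gevrey_norm_le_iff[OF assms(2) enn2real_nonneg] by blast
qed

lemma gevrey_stepI:
  assumes "u \<in> C_infty" "0 < h" "0 \<le> C"
    and "\<And>\<alpha> x. norm (D_multi \<alpha> (fun_of u) x) \<le> C * gevrey_weight h s \<alpha>"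
  shows "u \<in> gevrey_step h s" "enn2real (gevrey_norm h s u) \<le> C"
proof -
  have *: "gevrey_norm h s u \<le> ennreal C"
    using gevrey_norm_le_iff assms by blast
  then show "u \<in> gevrey_step h s"
    using assms(1) by (auto simp: gevrey_step_def intro: le_less_trans)
  show "enn2real (gevrey_norm h s u) \<le> C"
    using enn2real_mono[OF *] assms(3) by simp
qed

lemma C_infty_diff: "v \<in> C_infty \<Longrightarrow> u \<in> C_infty \<Longrightarrow> (\<lambda>\<phi>. v \<phi> - u \<phi>) \<in> C_infty"
  using C_infty_combination[of v u 1 "-1"] by simp

lemma regular_diff:
  assumes "v \<in> regular" "u \<in> regular"
  shows "(\<lambda>\<phi>. v \<phi> - u \<phi>) \<in> regular" "fun_of (\<lambda>\<phi>. v \<phi> - u \<phi>) = (\<lambda>x. fun_of v x - fun_of u x)"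
    "D_multi \<alpha> (fun_of (\<lambda>\<phi>. v \<phi> - u \<phi>)) x = D_multi \<alpha> (fun_of v) x - D_multi \<alpha> (fun_of u) x"
proof -
  show "(\<lambda>\<phi>. v \<phi> - u \<phi>) \<in> regular"
    using regular_combination(1)[OF assms, of 1 "-1"] by simp
  show e: "fun_of (\<lambda>\<phi>. v \<phi> - u \<phi>) = (\<lambda>x. fun_of v x - fun_of u x)"
    using regular_combination(2)[OF assms, of 1 "-1"] by simp
  show "D_multi \<alpha> (fun_of (\<lambda>\<phi>. v \<phi> - u \<phi>)) x = D_multi \<alpha> (fun_of v) x - D_multi \<alpha> (fun_of u) x"
    unfolding e
    using D_multi_combination[OF fun_of_regular(1)[OF assms(1)] fun_of_regular(1)[OF assms(2)], of \<alpha> 1 "-1"]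
    by simp
qed

text \<open>The centre \<open>u\<close> of a ball may be irregular. In that case the difference
  inherits the default value of \<open>fun_of u\<close>. In both cases the derivatives of the
  difference are bounded by the sum of the two norms.\<close>

lemma D_multi_fun_of_diff_cases:
  assumes "v \<in> regular"
  obtains "\<And>\<alpha> x. D_multi \<alpha> (fun_of (\<lambda>\<phi>. v \<phi> - u \<phi>)) x = D_multi \<alpha> (fun_of v) x - D_multi \<alpha> (fun_of u) x"
  | "u \<notin> regular" "\<And>\<alpha> x. D_multi \<alpha> (fun_of (\<lambda>\<phi>. v \<phi> - u \<phi>)) x = D_multi \<alpha> (fun_of u) x"
proof (cases "u \<in> regular")
  case True
  then show ?thesis using that(1) regular_diff(3)[OF assms] by blast
next
  case False
  then show ?thesis using that(2) by (simp add: fun_of_diff_irregular[OF assms])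
qed

lemma gevrey_step_diff:
  assumes v: "v \<in> regular" "v \<in> gevrey_step h s" and u: "u \<in> gevrey_step h s" and h: "0 < h"
  shows "(\<lambda>\<phi>. v \<phi> - u \<phi>) \<in> gevrey_step h s"
proof (rule gevrey_stepI(1))
  let ?N = "\<lambda>u. enn2real (gevrey_norm h s u)"
  show "(\<lambda>\<phi>. v \<phi> - u \<phi>) \<in> C_infty"
    using v u C_infty_diff by (auto simp: gevrey_step_def)
  fix \<alpha> x
  have b: "norm (D_multi \<alpha> (fun_of v) x) \<le> ?N v * gevrey_weight h s \<alpha>"
    "norm (D_multi \<alpha> (fun_of u) x) \<le> ?N u * gevrey_weight h s \<alpha>"
    using gevrey_step_bound v u h by blast+
  then have "norm (D_multi \<alpha> (fun_of v) x) + norm (D_multi \<alpha> (fun_of u) x) \<le> (?N v + ?N u) * gevrey_weight h s \<alpha>"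
    by (simp add: algebra_simps)
  moreover have "norm (D_multi \<alpha> (fun_of (\<lambda>\<phi>. v \<phi> - u \<phi>)) x)
      \<le> norm (D_multi \<alpha> (fun_of v) x) + norm (D_multi \<alpha> (fun_of u) x)"
    by (rule D_multi_fun_of_diff_cases[OF v(1), of u]) (simp_all add: norm_triangle_ineq4)
  ultimately show "norm (D_multi \<alpha> (fun_of (\<lambda>\<phi>. v \<phi> - u \<phi>)) x) \<le> (?N v + ?N u) * gevrey_weight h s \<alpha>"
    by linarith
qed (use h in auto)

text \<open>For regular \<open>u\<close> this is the pointwise triangle inequality. For irregular
  \<open>u\<close> the differences from \<open>v\<close> and from \<open>w\<close> have the same
  \<open>fun_of\<close>, so their norms agree.\<close>

lemma gevrey_norm_diff_le:
  assumes v: "v \<in> regular" "v \<in> gevrey_step h s" and w: "w \<in> regular" "w \<in> gevrey_step h s"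
    and u: "u \<in> gevrey_step h s" and h: "0 < h"
  shows "enn2real (gevrey_norm h s (\<lambda>\<phi>. v \<phi> - u \<phi>)) \<le>
    enn2real (gevrey_norm h s (\<lambda>\<phi>. w \<phi> - u \<phi>)) + enn2real (gevrey_norm h s (\<lambda>\<phi>. v \<phi> - w \<phi>))"
proof (rule gevrey_stepI(2))
  let ?N = "\<lambda>u. enn2real (gevrey_norm h s u)"
  show "(\<lambda>\<phi>. v \<phi> - u \<phi>) \<in> C_infty"
    using v u C_infty_diff by (auto simp: gevrey_step_def)
  fix \<alpha> x
  have "norm (D_multi \<alpha> (fun_of (\<lambda>\<phi>. v \<phi> - w \<phi>)) x) \<le> ?N (\<lambda>\<phi>. v \<phi> - w \<phi>) * gevrey_weight h s \<alpha>"
    "norm (D_multi \<alpha> (fun_of (\<lambda>\<phi>. w \<phi> - u \<phi>)) x) \<le> ?N (\<lambda>\<phi>. w \<phi> - u \<phi>) * gevrey_weight h s \<alpha>"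
    using gevrey_step_bound gevrey_step_diff v w u h by blast+
  then have *: "norm (D_multi \<alpha> (fun_of (\<lambda>\<phi>. w \<phi> - u \<phi>)) x) + norm (D_multi \<alpha> (fun_of (\<lambda>\<phi>. v \<phi> - w \<phi>)) x)
      \<le> (?N (\<lambda>\<phi>. w \<phi> - u \<phi>) + ?N (\<lambda>\<phi>. v \<phi> - w \<phi>)) * gevrey_weight h s \<alpha>"
    by (simp add: algebra_simps)
  have "norm (D_multi \<alpha> (fun_of (\<lambda>\<phi>. v \<phi> - u \<phi>)) x)
      \<le> norm (D_multi \<alpha> (fun_of (\<lambda>\<phi>. w \<phi> - u \<phi>)) x) + norm (D_multi \<alpha> (fun_of (\<lambda>\<phi>. v \<phi> - w \<phi>)) x)"
  proof (cases "u \<in> regular")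
    case True
    have "D_multi \<alpha> (fun_of v) x - D_multi \<alpha> (fun_of u) x = (D_multi \<alpha> (fun_of w) x - D_multi \<alpha> (fun_of u) x)
        + (D_multi \<alpha> (fun_of v) x - D_multi \<alpha> (fun_of w) x)" by simp
    then show ?thesis
      unfolding regular_diff(3)[OF v(1) True] regular_diff(3)[OF w(1) True] regular_diff(3)[OF v(1) w(1)]
      by (metis norm_triangle_ineq)
  next
    case False
    then show ?thesis
      by (simp add: fun_of_diff_irregular[OF v(1) False] fun_of_diff_irregular[OF w(1) False])
  qed
  with * show "norm (D_multi \<alpha> (fun_of (\<lambda>\<phi>. v \<phi> - u \<phi>)) x)
      \<le> (?N (\<lambda>\<phi>. w \<phi> - u \<phi>) + ?N (\<lambda>\<phi>. v \<phi> - w \<phi>)) * gevrey_weight h s \<alpha>"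
    by linarith
qed (use h in auto)

lemma gevrey_iff: "u \<in> gevrey s \<longleftrightarrow> u \<in> C_infty \<and>
    (\<exists>C>0. \<exists>h>0. \<forall>\<alpha> x. norm (D_multi \<alpha> (fun_of u) x) \<le> C * gevrey_weight h s \<alpha>)"
  by (simp add: gevrey_def gevrey_weight_def mult.assoc)

lemma gevrey_diff:
  assumes v: "v \<in> regular" "v \<in> gevrey s" and u: "u \<in> gevrey s"
  shows "(\<lambda>\<phi>. v \<phi> - u \<phi>) \<in> gevrey s"
proof -
  obtain C h where C: "0 < C" "0 < h" "\<And>\<alpha> x. norm (D_multi \<alpha> (fun_of v) x) \<le> C * gevrey_weight h s \<alpha>"
    using v(2) unfolding gevrey_iff by blast
  obtain C' h' where C': "0 < C'" "0 < h'" "\<And>\<alpha> x. norm (D_multi \<alpha> (fun_of u) x) \<le> C' * gevrey_weight h' s \<alpha>"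
    using u unfolding gevrey_iff by blast
  \<comment> \<open>The two elements may lie in different steps; a larger constant only weakens the
    bounds, so both lie in the step of the maximum.\<close>
  let ?h = "max h h'"
  have mono: "gevrey_weight k s \<alpha> \<le> gevrey_weight ?h s \<alpha>" if "0 < k" "k \<le> ?h" for k \<alpha>
    unfolding gevrey_weight_def using that by (intro mult_right_mono power_mono) auto
  have "norm (D_multi \<alpha> (fun_of (\<lambda>\<phi>. v \<phi> - u \<phi>)) x) \<le> (C + C') * gevrey_weight ?h s \<alpha>" for \<alpha> x
  proof -
    have "norm (D_multi \<alpha> (fun_of v) x) \<le> C * gevrey_weight ?h s \<alpha>"
      by (rule order_trans[OF C(3) mult_left_mono[OF mono]]) (use C in auto)
    moreover have "norm (D_multi \<alpha> (fun_of u) x) \<le> C' * gevrey_weight ?h s \<alpha>"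
      by (rule order_trans[OF C'(3) mult_left_mono[OF mono]]) (use C' in auto)
    moreover have "norm (D_multi \<alpha> (fun_of (\<lambda>\<phi>. v \<phi> - u \<phi>)) x)
        \<le> norm (D_multi \<alpha> (fun_of v) x) + norm (D_multi \<alpha> (fun_of u) x)"
      by (rule D_multi_fun_of_diff_cases[OF v(1), of u]) (simp_all add: norm_triangle_ineq4)
    ultimately show ?thesis by (simp add: algebra_simps)
  qed
  moreover have "0 < C + C'" "0 < ?h" using C C' by auto
  moreover have "(\<lambda>\<phi>. v \<phi> - u \<phi>) \<in> C_infty"
    using v u C_infty_diff by (auto simp: gevrey_iff)
  ultimately show ?thesis unfolding gevrey_iff by blast
qed

lemma gevrey_step_subset_gevrey: "0 < h \<Longrightarrow> gevrey_step h s \<subseteq> gevrey s"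
proof
  fix u assume h: "0 < h" and u: "u \<in> gevrey_step h s"
  \<comment> \<open>The norm can be 0, whereas the definition of \<open>gevrey\<close> asks for a
    positive constant.\<close>
  let ?C = "enn2real (gevrey_norm h s u) + 1"
  have "norm (D_multi \<alpha> (fun_of u) x) \<le> ?C * gevrey_weight h s \<alpha>" for \<alpha> x
    using gevrey_step_bound[OF u h, of \<alpha> x] gevrey_weight_pos[OF h, of s \<alpha>] by (simp add: algebra_simps)
  moreover have "0 < ?C" by (simp add: add_nonneg_pos)
  ultimately show "u \<in> gevrey s"
    using u h unfolding gevrey_iff by (auto simp: gevrey_step_def)
qed

section \<open>Curves with one active Fourier mode\<close>

text \<open>Balls form only a subbasis, but preimages of subbasic sets suffice. The centres
  \<open>u\<close> run through all of \<open>X\<close>, not only through the values of the curve. A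
  nonempty \<open>P\<close> is what makes the balls cover the curve.\<close>

lemma continuous_map_seminorm_topology:
  assumes "\<And>t. t \<in> S \<Longrightarrow> f t \<in> X" "P \<noteq> {}"
    and cont: "\<And>p u. p \<in> P \<Longrightarrow> u \<in> X \<Longrightarrow> continuous_on S (\<lambda>t. p (\<lambda>\<phi>. f t \<phi> - u \<phi>))"
  shows "continuous_map (top_of_set S) (seminorm_topology X P) f"
  unfolding seminorm_topology_def
proof (rule continuous_on_generated_topo)
  fix U assume "U \<in> {{v \<in> X. p (\<lambda>\<phi>. v \<phi> - u \<phi>) < e} | p u e. p \<in> P \<and> u \<in> X \<and> 0 < e}"
  then obtain p u e where U: "U = {v \<in> X. p (\<lambda>\<phi>. v \<phi> - u \<phi>) < e}" "p \<in> P" "u \<in> X" by blast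
  have "f -` U \<inter> topspace (top_of_set S) = S \<inter> (\<lambda>t. p (\<lambda>\<phi>. f t \<phi> - u \<phi>)) -` {..<e}"
    using assms(1) by (auto simp: U(1))
  then show "openin (top_of_set S) (f -` U \<inter> topspace (top_of_set S))"
    using continuous_openin_preimage_gen[OF cont[OF U(2,3)] open_lessThan] by simp
next
  obtain p where p: "p \<in> P" using assms(2) by blast
  have "\<exists>U\<in>{{v \<in> X. p (\<lambda>\<phi>. v \<phi> - u \<phi>) < e} | p u e. p \<in> P \<and> u \<in> X \<and> 0 < e}. f t \<in> U" if "t \<in> S" for t
  proof -
    \<comment> \<open>\<open>p\<close> is an arbitrary function here and need not vanish at 0; with
      this radius \<open>f t\<close> lies in the ball around itself.\<close>
    let ?e = "\<bar>p (\<lambda>\<phi>. f t \<phi> - f t \<phi>)\<bar> + 1"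
    have "f t \<in> {v \<in> X. p (\<lambda>\<phi>. v \<phi> - f t \<phi>) < ?e}"
      using assms(1) that by simp
    moreover have "0 < ?e" by linarith
    then have "{v \<in> X. p (\<lambda>\<phi>. v \<phi> - f t \<phi>) < ?e}
        \<in> {{v \<in> X. p (\<lambda>\<phi>. v \<phi> - u \<phi>) < e} | p u e. p \<in> P \<and> u \<in> X \<and> 0 < e}"
      using p assms(1)[OF that] \<open>0 < ?e\<close> by (intro CollectI exI[of _ p] exI[of _ "f t"] exI[of _ ?e]) simp
    ultimately show ?thesis by (rule bexI)
  qed
  then show "f ` topspace (top_of_set S)
      \<subseteq> \<Union> {{v \<in> X. p (\<lambda>\<phi>. v \<phi> - u \<phi>) < e} | p u e. p \<in> P \<and> u \<in> X \<and> 0 < e}"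
    unfolding topspace_euclidean_subtopology image_subset_iff Union_iff by (rule ballI)
qed

text \<open>One term of the exponential series is at most the whole series. This produces the
  factorial that the Gevrey bounds ask for.\<close>

lemma power_le_fact_mult_exp:
  fixes x :: real
  assumes "0 \<le> x"
  shows "x ^ n \<le> fact n * exp x"
proof -
  have "(\<Sum>k\<in>{n}. x ^ k /\<^sub>R fact k) \<le> (\<Sum>k. x ^ k /\<^sub>R fact k)"
    using assms by (intro sum_le_suminf summable_exp_generic) auto
  then show ?thesis by (simp add: exp_def field_simps)
qed

text \<open>Just what continuity in all the spaces rests on: one active mode at a time, continuous
  coefficients, and decay uniform in time. At times when all coefficients vanish
  \<open>active\<close> may be any index, and \<open>force\<close> is zero.\<close>

locale mode_curve =
  fixes S :: "real set" and c :: "nat \<Rightarrow> real \<Rightarrow> complex" and active :: "real \<Rightarrow> nat"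
    and j0 :: "'n::finite" and M :: real
  assumes continuous_c: "\<And>k. continuous_on S (c k)"
    and inactive: "\<And>k t. t \<in> S \<Longrightarrow> k \<noteq> active t \<Longrightarrow> c k t = 0"
    and decay: "\<And>k t. t \<in> S \<Longrightarrow> norm (c k t) \<le> M * exp (- real k)"
begin

definition freq :: "nat \<Rightarrow> int^'n" where "freq k = axis j0 (int k)"

definition wave :: "nat \<Rightarrow> 'n functional" where "wave k = dist_of (mode (freq k))"

definition force :: "real \<Rightarrow> 'n functional" where
  "force t = (\<lambda>\<phi>. c (active t) t * wave (active t) \<phi>)"

lemma freq_component: "\<bar>real_of_int (freq k $ j)\<bar> \<le> real k"
  by (simp add: freq_def axis_def)

lemma norm_freq: "norm (real_freq (freq k)) = real k"
proof -
  have "real_freq (freq k) = axis j0 (real k)"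
    by (simp add: vec_eq_iff freq_def axis_def)
  then show ?thesis by (simp add: norm_eq_sqrt_inner inner_axis_axis)
qed

text \<open>The second wave with coefficient 0 puts a value of the force into the form with two
  waves in which differences of values appear.\<close>

lemma force_eq: "force t = (\<lambda>\<phi>. c (active t) t * wave (active t) \<phi> + 0 * wave 0 \<phi>)"
  by (simp add: force_def)

text \<open>At two times at most two modes are active. If they differ, each coefficient vanishes at
  the other time; if they coincide, the first wave carries the whole difference and
  \<open>b = 0\<close>. A mere bound on \<open>b\<close> covers both cases.\<close>

lemma force_diff:
  assumes "s \<in> S" "t \<in> S"
  obtains b where "norm b \<le> norm (c (active t) s - c (active t) t)"
    "(\<lambda>\<phi>. force s \<phi> - force t \<phi>)
      = (\<lambda>\<phi>. (c (active s) s - c (active s) t) * wave (active s) \<phi> + b * wave (active t) \<phi>)"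
proof (cases "active s = active t")
  case True
  then show ?thesis by (intro that[of 0]) (auto simp: force_def algebra_simps)
next
  case False
  then have "c (active s) t = 0" "c (active t) s = 0"
    using inactive assms by metis+
  then show ?thesis
    by (intro that[of "c (active t) s - c (active t) t"]) (auto simp: force_def)
qed

text \<open>\<open>B k\<close> bounds the size of the k-th wave. High modes are small uniformly in
  time because their decay beats \<open>B\<close>; the finitely many low ones have continuous
  coefficients. The function \<open>g\<close> enters through a triangle inequality only, so it can
  be the distance to any centre.\<close>

lemma continuous_on_force_seminorm:
  fixes q :: "'n functional \<Rightarrow> real"
  assumes B: "\<And>k. 0 \<le> B k" "(\<lambda>k. exp (- real k) * B k) \<longlonglongrightarrow> 0"
    and q: "\<And>a b k l. q (\<lambda>\<phi>. a * wave k \<phi> + b * wave l \<phi>) \<le> norm a * B k + norm b * B l"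
    and g: "\<And>s t. s \<in> S \<Longrightarrow> t \<in> S \<Longrightarrow> g s \<le> g t + q (\<lambda>\<phi>. force s \<phi> - force t \<phi>)"
  shows "continuous_on S g"
  unfolding continuous_on_iff dist_real_def
proof (intro ballI allI impI)
  fix t e :: real assume t: "t \<in> S" and e: "0 < e"
  have "(\<lambda>k. M * (exp (- real k) * B k)) \<longlonglongrightarrow> M * 0"
    by (intro tendsto_intros B)
  \<comment> \<open>A quarter, because up to two modes contribute to a difference and each of them
    is bounded at two times.\<close>
  then have "\<forall>\<^sub>F k in sequentially. M * (exp (- real k) * B k) < e / 4"
    using e by (intro order_tendstoD) auto
  then obtain K where K: "\<And>k. K \<le> k \<Longrightarrow> M * (exp (- real k) * B k) < e / 4"
    unfolding eventually_sequentially by blast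
  have "\<forall>\<^sub>F s in at t within S. norm (c k s - c k t) * B k < e / 2" for k
  proof -
    have "((\<lambda>s. norm (c k s - c k t) * B k) \<longlongrightarrow> norm (c k t - c k t) * B k) (at t within S)"
      using continuous_c[of k] t by (intro tendsto_intros) (auto simp: continuous_on_def)
    then show ?thesis using e by (intro order_tendstoD) auto
  qed
  then have "\<forall>\<^sub>F s in at t within S. \<forall>k\<in>{..<K}. norm (c k s - c k t) * B k < e / 2"
    by (intro eventually_ball_finite) auto
  then obtain d where d: "0 < d"
    "\<And>s k. s \<in> S \<Longrightarrow> s \<noteq> t \<Longrightarrow> dist s t < d \<Longrightarrow> k < K \<Longrightarrow> norm (c k s - c k t) * B k < e / 2"
    unfolding eventually_at by auto
  have small: "norm (c k s - c k t) * B k < e / 2" if "s \<in> S" "dist s t < d" for s k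
  proof (cases "s = t \<or> k < K")
    case True
    then show ?thesis using d(2)[OF that(1) _ that(2)] e by (cases "s = t") auto
  next
    case False
    have "norm (c k s - c k t) * B k \<le> (M * exp (- real k) + M * exp (- real k)) * B k"
      using decay[OF that(1), of k] decay[OF t, of k] B(1)[of k] norm_triangle_ineq4[of "c k s" "c k t"]
      by (intro mult_right_mono) auto
    also have "\<dots> < e / 2" using K[of k] False by (simp add: algebra_simps)
    finally show ?thesis .
  qed
  \<comment> \<open>One-sided and for both orders of the two times, since no symmetry of
    \<open>q\<close> is assumed.\<close>
  have less: "g s < g s' + e" if ss: "s \<in> S" "s' \<in> S" "s = t \<and> dist s' t < d \<or> s' = t \<and> dist s t < d" for s s'
  proof -
    obtain b where b: "norm b \<le> norm (c (active s') s - c (active s') s')"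
      "(\<lambda>\<phi>. force s \<phi> - force s' \<phi>)
        = (\<lambda>\<phi>. (c (active s) s - c (active s) s') * wave (active s) \<phi> + b * wave (active s') \<phi>)"
      by (rule force_diff[OF ss(1,2)])
    have "norm (c k s - c k s') * B k < e / 2" for k
      using that(3) small[of s k] small[of s' k] that(1,2) by (auto simp: norm_minus_commute)
    note this[of "active s"] this[of "active s'"]
    moreover have "norm b * B (active s') \<le> norm (c (active s') s - c (active s') s') * B (active s')"
      using b(1) B(1) by (intro mult_right_mono) auto
    moreover note q[of "c (active s) s - c (active s) s'" "active s" b "active s'"] g[OF that(1,2)]
    ultimately show ?thesis unfolding b(2) by linarith
  qed
  show "\<exists>d>0. \<forall>x'\<in>S. \<bar>x' - t\<bar> < d \<longrightarrow> \<bar>g x' - g t\<bar> < e"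
  proof (intro exI[of _ d] conjI ballI impI d(1))
    fix s assume "s \<in> S" "\<bar>s - t\<bar> < d"
    then show "\<bar>g s - g t\<bar> < e"
      using less[of s t] less[of t s] t by (auto simp: dist_real_def abs_less_iff)
  qed
qed

section \<open>Continuity of the force in each function space\<close>

lemma force_sobolev: "force t \<in> sobolev r"
  unfolding force_eq wave_def by (intro sobolev_combination dist_of_mode_sobolev)

lemma force_C_infty: "force t \<in> C_infty"
  by (simp add: C_infty_def force_sobolev)

lemma force_continuous_sobolev: "continuous_map (top_of_set S) (sobolev_topology r) force"
  unfolding sobolev_topology_def
proof (rule continuous_map_seminorm_topology)
  fix p :: "'n functional \<Rightarrow> real" and u :: "'n functional" assume "p \<in> {sobolev_norm r}" and u: "u \<in> sobolev r"
  then have p: "p = sobolev_norm r" by simp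
  let ?B = "\<lambda>k. (1 + real k) powr r"
  show "continuous_on S (\<lambda>t. p (\<lambda>\<phi>. force t \<phi> - u \<phi>))"
    unfolding p
  proof (rule continuous_on_force_seminorm)
    show "(\<lambda>k. exp (- real k) * ?B k) \<longlonglongrightarrow> 0" by real_asymp
    fix a b k l
    have "sobolev_norm r (\<lambda>\<phi>. a * wave k \<phi> + b * wave l \<phi>)
        \<le> norm a * sobolev_norm r (wave k) + norm b * sobolev_norm r (wave l)"
      unfolding wave_def by (intro sobolev_combination dist_of_mode_sobolev)
    also have "\<dots> \<le> norm a * ?B k + norm b * ?B l"
      using sobolev_norm_dist_of_mode[of r "freq k"] sobolev_norm_dist_of_mode[of r "freq l"]
      by (intro add_mono mult_left_mono) (auto simp: wave_def sobolev_weight_def norm_freq)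
    finally show "sobolev_norm r (\<lambda>\<phi>. a * wave k \<phi> + b * wave l \<phi>) \<le> norm a * ?B k + norm b * ?B l" .
  next
    fix s t
    have diff: "(\<lambda>\<phi>. v \<phi> - w \<phi>) \<in> sobolev r" if "v \<in> sobolev r" "w \<in> sobolev r" for v w :: "'n functional"
      using sobolev_combination(1)[OF that, of 1 "-1"] by simp
    have "(\<lambda>\<phi>. force s \<phi> - u \<phi>) = (\<lambda>\<phi>. 1 * (force t \<phi> - u \<phi>) + 1 * (force s \<phi> - force t \<phi>))"
      by simp
    then show "sobolev_norm r (\<lambda>\<phi>. force s \<phi> - u \<phi>) \<le>
        sobolev_norm r (\<lambda>\<phi>. force t \<phi> - u \<phi>) + sobolev_norm r (\<lambda>\<phi>. force s \<phi> - force t \<phi>)"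
      using sobolev_combination(2)[OF diff[OF force_sobolev u] diff[OF force_sobolev force_sobolev], of 1 t 1 s t]
      by simp
  qed simp
qed (auto simp: force_sobolev)

lemma force_continuous_C_infty: "continuous_map (top_of_set S) C_infty_topology force"
  unfolding C_infty_topology_def
proof (rule continuous_on_generated_topo)
  fix U :: "'n functional set" assume "U \<in> {C_infty \<inter> U | r U. openin (sobolev_topology r) U}"
  then obtain r V where "U = C_infty \<inter> V" "openin (sobolev_topology r) V" by blast
  then have "force -` U \<inter> topspace (top_of_set S) = {x \<in> topspace (top_of_set S). force x \<in> V}"
    by (auto simp: force_C_infty)
  then show "openin (top_of_set S) (force -` U \<inter> topspace (top_of_set S))"
    using openin_continuous_map_preimage[OF force_continuous_sobolev \<open>openin _ V\<close>] by simp
next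
  have "force t \<in> topspace (sobolev_topology 0)" if "t \<in> S" for t
    using continuous_map_image_subset_topspace[OF force_continuous_sobolev[of 0]] that by auto
  then show "force ` topspace (top_of_set S) \<subseteq> \<Union> {C_infty \<inter> U | r U. openin (sobolev_topology r) U}"
    using force_C_infty by (intro subsetI UnionI[of "C_infty \<inter> topspace (sobolev_topology 0)"] CollectI
        exI[of _ 0] exI[of _ "topspace (sobolev_topology 0)"]) auto
qed

text \<open>Writing \<open>real k ^ n\<close> as \<open>2 ^ n * (real k / 2) ^ n\<close> and
  bounding the last factor by \<open>fact n * exp (real k / 2)\<close> gives the step constant 2.
  With it the growth exp (k / 2) stays below the inverse of the decay exp (-k). The hypothesis
  \<open>1 \<le> s\<close> lets the factorial be replaced by its power.\<close>

lemma
  fixes a b :: complex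
  defines "w \<equiv> (\<lambda>k l \<phi>. a * wave k \<phi> + b * wave l \<phi>)"
  shows waves_regular: "w k l \<in> regular"
    and waves_gevrey_step: "1 \<le> s \<Longrightarrow> w k l \<in> gevrey_step 2 s"
    and gevrey_norm_waves: "1 \<le> s \<Longrightarrow>
      enn2real (gevrey_norm 2 s (w k l)) \<le> norm a * exp (real k / 2) + norm b * exp (real l / 2)"
proof -
  have F: "wave k = dist_of (mode (freq k))" for k by (simp add: wave_def)
  let ?F = "\<lambda>x. a * mode (freq k) x + b * mode (freq l) x"
  have w: "w k l = dist_of ?F"
    unfolding w_def F by (rule dist_of_combination[symmetric]) (rule mode_torus_smooth)+
  have T: "?F \<in> torus_smooth" by (intro torus_smooth_combination mode_torus_smooth)
  show "w k l \<in> regular" unfolding w regular_iff using T by blast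
  have C: "w k l \<in> C_infty"
    unfolding w_def F by (intro C_infty_combination dist_of_mode_C_infty)
  assume s: "1 \<le> s"
  have pw: "real k ^ mlength \<alpha> \<le> exp (real k / 2) * gevrey_weight 2 s \<alpha>" for k and \<alpha> :: "'n \<Rightarrow> nat"
  proof -
    have "real k ^ mlength \<alpha> = 2 ^ mlength \<alpha> * (real k / 2) ^ mlength \<alpha>"
      by (simp add: power_divide)
    also have "\<dots> \<le> 2 ^ mlength \<alpha> * (fact (mlength \<alpha>) * exp (real k / 2))"
      by (intro mult_left_mono power_le_fact_mult_exp) auto
    also have "\<dots> \<le> 2 ^ mlength \<alpha> * (fact (mlength \<alpha>) powr s * exp (real k / 2))"
      using powr_mono[OF s, of "fact (mlength \<alpha>)"] fact_ge_1 by (intro mult_left_mono mult_right_mono) auto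
    finally show ?thesis by (simp add: gevrey_weight_def mult_ac)
  qed
  have "norm (D_multi \<alpha> (fun_of (w k l)) x)
      \<le> (norm a * exp (real k / 2) + norm b * exp (real l / 2)) * gevrey_weight 2 s \<alpha>" for \<alpha> x
  proof -
    have m: "norm (D_multi \<alpha> (mode (freq k)) x) \<le> exp (real k / 2) * gevrey_weight 2 s \<alpha>" for k
      using norm_D_multi_cmult_mode_le[OF freq_component, of \<alpha> 1 k x] pw[of k \<alpha>] by simp
    have "norm (D_multi \<alpha> (fun_of (w k l)) x)
        \<le> norm a * norm (D_multi \<alpha> (mode (freq k)) x) + norm b * norm (D_multi \<alpha> (mode (freq l)) x)"
      unfolding w fun_of_dist_of[OF T] D_multi_combination[OF mode_torus_smooth mode_torus_smooth]
      by (rule norm_triangle_le) (simp add: norm_mult)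
    also have "\<dots> \<le> norm a * (exp (real k / 2) * gevrey_weight 2 s \<alpha>) + norm b * (exp (real l / 2) * gevrey_weight 2 s \<alpha>)"
      by (intro add_mono mult_left_mono m) auto
    finally show ?thesis by (simp add: algebra_simps)
  qed
  note * = gevrey_stepI[OF C _ _ this]
  show "w k l \<in> gevrey_step 2 s" by (rule *(1)) auto
  show "enn2real (gevrey_norm 2 s (w k l)) \<le> norm a * exp (real k / 2) + norm b * exp (real l / 2)"
    by (rule *(2)) auto
qed

lemma force_regular: "force t \<in> regular"
  unfolding force_eq by (rule waves_regular)

lemma force_gevrey_step: "1 \<le> s \<Longrightarrow> force t \<in> gevrey_step 2 s"
  unfolding force_eq by (rule waves_gevrey_step)

lemma force_gevrey: "1 \<le> s \<Longrightarrow> force t \<in> gevrey s"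
  using force_gevrey_step gevrey_step_subset_gevrey[of 2 s] by auto

text \<open>The curve is recentred at one of its own values. It then stays in a single step, where
  seminorms of the inductive limit are known to be continuous, whatever step the centre of a ball
  belongs to.\<close>

lemma force_diff_continuous_gevrey_step:
  assumes s: "1 \<le> s"
  shows "continuous_map (top_of_set S) (gevrey_step_topology 2 s) (\<lambda>t \<phi>. force t \<phi> - force t0 \<phi>)"
  unfolding gevrey_step_topology_def
proof (rule continuous_map_seminorm_topology)
  let ?N = "\<lambda>u :: 'n functional. enn2real (gevrey_norm 2 s u)"
  let ?v = "\<lambda>t \<phi>. force t \<phi> - force t0 \<phi>"
  have v: "?v t \<in> regular" "?v t \<in> gevrey_step 2 s" for t
    using s by (auto intro!: regular_diff(1) gevrey_step_diff force_regular force_gevrey_step)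
  then show "?v t \<in> gevrey_step 2 s" for t by blast
  fix p :: "'n functional \<Rightarrow> real" and u :: "'n functional" assume "p \<in> {?N}" and u: "u \<in> gevrey_step 2 s"
  then have p: "p = ?N" by simp
  show "continuous_on S (\<lambda>t. p (\<lambda>\<phi>. ?v t \<phi> - u \<phi>))"
    unfolding p
  proof (rule continuous_on_force_seminorm)
    show "(\<lambda>k. exp (- real k) * exp (real k / 2)) \<longlonglongrightarrow> 0" by real_asymp
    show "?N (\<lambda>\<phi>. a * wave k \<phi> + b * wave l \<phi>) \<le> norm a * exp (real k / 2) + norm b * exp (real l / 2)" for a b k l
      by (rule gevrey_norm_waves[OF s])
    show "?N (\<lambda>\<phi>. ?v t' \<phi> - u \<phi>) \<le> ?N (\<lambda>\<phi>. ?v t \<phi> - u \<phi>) + ?N (\<lambda>\<phi>. force t' \<phi> - force t \<phi>)" for t' t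
      using gevrey_norm_diff_le[OF v v u, of t' t] by simp
  qed simp
qed simp

text \<open>A generating seminorm \<open>p\<close> is controlled only on the steps. Composed with
  the recentred curve in the step with constant 2 it tends to 0, and the triangle inequality carries
  this over to an arbitrary centre \<open>u\<close>.\<close>

lemma force_continuous_gevrey:
  assumes s: "1 \<le> s"
  shows "continuous_map (top_of_set S) (gevrey_topology s) force"
  unfolding gevrey_topology_def
proof (rule continuous_map_seminorm_topology)
  have "seminorm_on (gevrey s) (\<lambda>_ :: 'n functional. 0)"
    by (simp add: seminorm_on_def)
  then show "{p. seminorm_on (gevrey s :: 'n functional set) p \<and>
      (\<forall>h>0. continuous_map (gevrey_step_topology h s) euclideanreal p)} \<noteq> {}"
    by (auto intro!: exI[of _ "\<lambda>_. 0"])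
  fix p :: "'n functional \<Rightarrow> real" and u :: "'n functional"
  assume p: "p \<in> {p. seminorm_on (gevrey s) p \<and> (\<forall>h>0. continuous_map (gevrey_step_topology h s) euclideanreal p)}"
    and u: "u \<in> gevrey s"
  then have add: "p (\<lambda>\<phi>. v \<phi> + w \<phi>) \<le> p v + p w" if "v \<in> gevrey s" "w \<in> gevrey s" for v w
    using that by (auto simp: seminorm_on_def)
  have scale: "p (\<lambda>\<phi>. a * v \<phi>) = norm a * p v" if "v \<in> gevrey s" for v a
    using p that by (auto simp: seminorm_on_def)
  have diff: "(\<lambda>\<phi>. force t \<phi> - v \<phi>) \<in> gevrey s" if "v \<in> gevrey s" for t v
    by (intro gevrey_diff that force_regular force_gevrey s)
  show "continuous_on S (\<lambda>t. p (\<lambda>\<phi>. force t \<phi> - u \<phi>))"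
    unfolding continuous_on_def
  proof
    fix t0 assume t0: "t0 \<in> S"
    have "continuous_on S (\<lambda>t. p (\<lambda>\<phi>. force t \<phi> - force t0 \<phi>))"
      using continuous_map_compose[OF force_diff_continuous_gevrey_step[OF s, of t0], of euclideanreal p] p
      by (simp add: o_def)
    then have "((\<lambda>t. p (\<lambda>\<phi>. force t \<phi> - force t0 \<phi>)) \<longlongrightarrow> p (\<lambda>\<phi>. force t0 \<phi> - force t0 \<phi>)) (at t0 within S)"
      using t0 unfolding continuous_on_def by (rule bspec)
    moreover have "p (\<lambda>\<phi>. force t0 \<phi> - force t0 \<phi>) = 0"
      using scale[OF force_gevrey[OF s], of 0 t0] by simp
    ultimately have lim: "((\<lambda>t. p (\<lambda>\<phi>. force t \<phi> - force t0 \<phi>)) \<longlongrightarrow> 0) (at t0 within S)"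
      by simp
    have "\<bar>p (\<lambda>\<phi>. force t \<phi> - u \<phi>) - p (\<lambda>\<phi>. force t0 \<phi> - u \<phi>)\<bar> \<le> p (\<lambda>\<phi>. force t \<phi> - force t0 \<phi>)" for t
    proof -
      have "p (\<lambda>\<phi>. force t0 \<phi> - force t \<phi>) = p (\<lambda>\<phi>. force t \<phi> - force t0 \<phi>)"
        using scale[OF diff[OF force_gevrey[OF s]], of "-1" t t0] by simp
      then show ?thesis
        using add[OF diff[OF u, of t0] diff[OF force_gevrey[OF s], of t t0]]
          add[OF diff[OF u, of t] diff[OF force_gevrey[OF s], of t0 t]]
        by simp
    qed
    then show "((\<lambda>t. p (\<lambda>\<phi>. force t \<phi> - u \<phi>)) \<longlongrightarrow> p (\<lambda>\<phi>. force t0 \<phi> - u \<phi>)) (at t0 within S)"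
      by (intro Lim_null_comparison[OF _ lim, THEN LIM_zero_cancel]) (auto intro: always_eventually)
  qed
qed (use force_gevrey s in auto)

lemma force_mode:
  assumes "t \<in> S"
  shows "force t (mode (- freq k)) = c k t"
proof -
  have "freq l + - freq k = 0 \<longleftrightarrow> l = k" for l
    by (auto simp: freq_def vec_eq_iff axis_def)
  then show ?thesis
    using inactive[OF assms, of k] by (auto simp: force_def wave_def dist_of_mode)
qed

end

section \<open>Smooth bump functions on the line\<close>

lemma dir_deriv_1_eq: "(f has_vector_derivative f') (at x) \<Longrightarrow> dir_deriv 1 f x = f'"
  using dir_deriv_eq[of f "\<lambda>h. h *\<^sub>R f'" x 1] by (simp add: has_vector_derivative_def)

text \<open>The function exp (-1/x), extended by 0 to the left; the polynomial in 1/x makes the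
  class closed under differentiation.\<close>

definition flat :: "real poly \<Rightarrow> real \<Rightarrow> real" where
  "flat P x = (if 0 < x then poly P (inverse x) * exp (- inverse x) else 0)"

definition flat_deriv :: "real poly \<Rightarrow> real poly" where
  "flat_deriv P = [:0, 0, 1:] * (P - pderiv P)"

lemma poly_mult_exp_minus_tendsto_0:
  "((\<lambda>x. poly P x * exp (- x)) \<longlongrightarrow> (0::real)) at_top"
proof -
  \<comment> \<open>The extra power carries the induction: splitting off the constant term of the
    polynomial raises \<open>k\<close> by one.\<close>
  have "((\<lambda>x. x ^ k * poly P x * exp (- x)) \<longlongrightarrow> 0) at_top" for k
  proof (induction P arbitrary: k)
    case (pCons a P)
    have "((\<lambda>x. a * (x ^ k / exp x) + x ^ Suc k * poly P x * exp (- x)) \<longlongrightarrow> a * 0 + 0) at_top"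
      by (intro tendsto_intros tendsto_power_div_exp_0 pCons.IH)
    then show ?case by (simp add: algebra_simps exp_minus divide_inverse)
  qed simp
  from this[of 0] show ?thesis by simp
qed

lemma flat_has_derivative: "(flat P has_real_derivative flat (flat_deriv P) x) (at x)"
proof -
  consider "0 < x" | "x < 0" | "x = 0" by linarith
  then show ?thesis
  proof cases
    case 1
    have "((\<lambda>x. poly P (inverse x) * exp (- inverse x)) has_real_derivative flat (flat_deriv P) x) (at x)"
      using 1 by (auto intro!: derivative_eq_intros simp: flat_def flat_deriv_def field_simps power2_eq_square)
    then show ?thesis
      by (rule has_field_derivative_transform_within_open[where S = "{0<..}"]) (use 1 in \<open>auto simp: flat_def\<close>)
  next
    case 2
    have "((\<lambda>_. 0) has_real_derivative flat (flat_deriv P) x) (at x)"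
      using 2 by (simp add: flat_def)
    then show ?thesis
      by (rule has_field_derivative_transform_within_open[where S = "{..<0}"]) (use 2 in \<open>auto simp: flat_def\<close>)
  next
    case 3
    have "((\<lambda>h. flat P h / h) \<longlongrightarrow> 0) (at_left 0)"
      by (rule tendsto_eventually) (auto simp: flat_def eventually_at_filter)
    moreover have "((\<lambda>h. flat P h / h) \<longlongrightarrow> 0) (at_right 0)"
    proof (rule Lim_transform_eventually)
      \<comment> \<open>Division by \<open>h\<close> multiplies the polynomial in 1/h by its
        variable, hence \<open>pCons 0 P\<close>.\<close>
      show "((\<lambda>h. poly (pCons 0 P) (inverse h) * exp (- inverse h)) \<longlongrightarrow> 0) (at_right 0)"
        by (rule filterlim_compose[OF poly_mult_exp_minus_tendsto_0 filterlim_inverse_at_top_right])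
      show "\<forall>\<^sub>F h in at_right 0. poly (pCons 0 P) (inverse h) * exp (- inverse h) = flat P h / h"
        by (auto simp: eventually_at_filter flat_def divide_inverse)
    qed
    ultimately have "((\<lambda>h. flat P h / h) \<longlongrightarrow> 0) (at 0)"
      by (rule filterlim_split_at)
    then show ?thesis
      using 3 by (simp add: has_field_derivative_iff flat_def)
  qed
qed

lemma smooth_flat_affine: "smooth (\<lambda>x. complex_of_real (flat P (\<sigma> * x + a)))"
proof -
  have "\<exists>P'. (\<lambda>x. complex_of_real (flat P (\<sigma> * x + a))) = (\<lambda>x. complex_of_real (flat P' (\<sigma> * x + a)))"
    by blast
  then show ?thesis
  proof (rule smooth_coinduct[where P = "\<lambda>f. \<exists>P. f = (\<lambda>x. complex_of_real (flat P (\<sigma> * x + a)))"])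
    fix f assume "\<exists>P. f = (\<lambda>x. complex_of_real (flat P (\<sigma> * x + a)))"
    then obtain P where f: "f = (\<lambda>x. complex_of_real (flat P (\<sigma> * x + a)))" by blast
    have d: "(f has_vector_derivative complex_of_real (flat (smult \<sigma> (flat_deriv P)) (\<sigma> * x + a))) (at x)" for x
    proof -
      have "((\<lambda>x. \<sigma> * x + a) has_real_derivative \<sigma>) (at x)"
        by (auto intro!: derivative_eq_intros)
      from DERIV_chain2[OF flat_has_derivative this]
      have "((\<lambda>x. flat P (\<sigma> * x + a)) has_real_derivative flat (flat_deriv P) (\<sigma> * x + a) * \<sigma>) (at x)" .
      then have "((\<lambda>x. complex_of_real (flat P (\<sigma> * x + a))) has_vector_derivative
          complex_of_real (flat (flat_deriv P) (\<sigma> * x + a) * \<sigma>)) (at x)"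
        unfolding has_real_derivative_iff_has_vector_derivative
        by (rule bounded_linear.has_vector_derivative[OF bounded_linear_of_real])
      moreover have "flat (flat_deriv P) z * \<sigma> = flat (smult \<sigma> (flat_deriv P)) z" for z
        by (simp add: flat_def)
      ultimately show ?thesis unfolding f by simp
    qed
    have "dir_deriv 1 f = (\<lambda>x. complex_of_real (flat (smult \<sigma> (flat_deriv P)) (\<sigma> * x + a)))"
      using dir_deriv_1_eq[OF d] by blast
    moreover have "f differentiable_on UNIV"
      using d unfolding differentiable_on_def
      by (blast intro: differentiableI_vector)
    ultimately show "f differentiable_on UNIV \<and>
        (\<forall>b\<in>Basis. \<exists>P. dir_deriv b f = (\<lambda>x. complex_of_real (flat P (\<sigma> * x + a))))"
      by auto
  qed
qed

text \<open>The first argument is the length, the second the left end of the support. Bumps of equal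
  length are translates of each other, so their integrals agree.\<close>

definition bump :: "real \<Rightarrow> real \<Rightarrow> real \<Rightarrow> real" where
  "bump e a x = flat 1 (x - a) * flat 1 (a + e - x)"

lemma smooth_bump: "smooth (\<lambda>x. complex_of_real (bump e a x))"
proof -
  have "smooth (\<lambda>x. complex_of_real (flat 1 (1 * x + (- a))) * complex_of_real (flat 1 ((-1) * x + (a + e))))"
    by (intro smooth_mult smooth_flat_affine)
  then show ?thesis by (simp add: bump_def algebra_simps)
qed

lemma bump_nonneg: "0 \<le> bump e a x"
  by (simp add: bump_def flat_def)

lemma bump_outside: "x \<notin> {a<..<a + e} \<Longrightarrow> bump e a x = 0"
  by (auto simp: bump_def flat_def)

lemma bump_shift: "bump e a x = bump e 0 (x - a)"
  by (simp add: bump_def algebra_simps)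

lemma continuous_on_bump: "continuous_on S (bump e a)"
proof -
  have "isCont (flat 1) x" for x
    using flat_has_derivative DERIV_isCont by blast
  then have flat: "continuous_on UNIV (flat 1)" by (simp add: continuous_at_imp_continuous_on)
  have "continuous_on S (\<lambda>x. flat 1 (x - a))" "continuous_on S (\<lambda>x. flat 1 (a + e - x))"
    by (rule continuous_on_compose2[OF flat]; simp add: continuous_intros)+
  then show ?thesis
    unfolding bump_def by (rule continuous_on_mult)
qed

lemma bump_has_integral:
  assumes "{a..a + e} \<subseteq> S"
  shows "(bump e a has_integral integral {0..e} (bump e 0)) S"
proof -
  have "(bump e 0 has_integral integral {0..e} (bump e 0)) {0..e}"
    by (intro integrable_integral integrable_continuous_real continuous_on_bump)
  from has_integral_shift_real_ivl[OF this, of "- a"]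
  have "(bump e a has_integral integral {0..e} (bump e 0)) {a..a + e}"
    by (simp add: bump_shift[of e a, symmetric] add.commute)
  then show ?thesis
    by (rule has_integral_on_superset) (use assms bump_outside in auto)
qed

lemma bump_integral_pos:
  assumes "0 < e"
  shows "0 < integral {0..e} (bump e 0)"
proof -
  have "0 \<le> integral {0..e} (bump e 0)"
    by (intro integral_nonneg integrable_continuous_real continuous_on_bump bump_nonneg)
  moreover have "integral {0..e} (bump e 0) \<noteq> 0"
  proof
    assume "integral {0..e} (bump e 0) = 0"
    then have "(bump e 0 has_integral 0) (cbox 0 e)"
      using bump_has_integral[of 0 e "{0..e}"] by simp
    then have "bump e 0 (e / 2) = 0"
      by (rule has_integral_0_cbox_imp_0[rotated 2]) (use assms continuous_on_bump bump_nonneg in auto)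
    then show False using assms by (simp add: bump_def flat_def)
  qed
  ultimately show ?thesis by linarith
qed

section \<open>The weak time derivative\<close>

lemma time_test_has_vector_derivative:
  assumes "\<phi> \<in> time_test T"
  shows "(\<phi> has_vector_derivative vector_derivative \<phi> (at t)) (at t)"
  using assms unfolding vector_derivative_works[symmetric]
  by (intro smooth_imp_differentiable) (simp add: time_test_def)

lemma time_test_continuous_on: "\<phi> \<in> time_test T \<Longrightarrow> continuous_on S \<phi>"
  by (simp add: time_test_def smooth_imp_continuous_on)

lemma time_test_derivative_continuous_on:
  assumes "\<phi> \<in> time_test T"
  shows "continuous_on S (\<lambda>t. vector_derivative \<phi> (at t))"
proof -
  have "dir_deriv 1 \<phi> = (\<lambda>t. vector_derivative \<phi> (at t))"
    using dir_deriv_1_eq[OF time_test_has_vector_derivative[OF assms]] by blast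
  moreover have "smooth (dir_deriv 1 \<phi>)"
    using assms by (intro smooth_dir_deriv) (auto simp: time_test_def)
  ultimately show ?thesis using smooth_imp_continuous_on by metis
qed

lemma time_test_endpoints:
  assumes "\<phi> \<in> time_test T"
  shows "\<phi> 0 = 0 \<and> \<phi> T = 0"
proof -
  obtain K where K: "K \<subseteq> {0<..<T}" "\<And>t. t \<notin> K \<Longrightarrow> \<phi> t = 0"
    using assms by (auto simp: time_test_def)
  then have "0 \<notin> K" "T \<notin> K" by auto
  then show ?thesis using K by blast
qed

text \<open>The two bumps have equal integrals, so the primitive that starts at 0 returns to 0 after
  both and has compact support. On negative times the interval \<open>{0..t}\<close> is empty and
  the primitive is 0 as well.\<close>

lemma bump_difference_primitive:
  assumes e: "0 < e" and ab: "0 < a" "0 < b" "a + e < T" "b + e < T"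
  obtains \<phi> where "\<phi> \<in> time_test T"
    "\<And>t. vector_derivative \<phi> (at t) = complex_of_real (bump e a t) - complex_of_real (bump e b t)"
proof -
  let ?g = "\<lambda>t. complex_of_real (bump e a t) - complex_of_real (bump e b t)"
  define \<phi> where "\<phi> t = integral {0..t} ?g" for t
  have smooth_g: "smooth ?g"
    using smooth_add[OF smooth_bump[of e a] smooth_cmult[OF smooth_bump[of e b], of "-1"]] by simp
  have low: "\<phi> t = 0" if "t \<le> min a b" for t
  proof -
    have "\<phi> t = integral {0..t} (\<lambda>_. 0)"
      unfolding \<phi>_def using that by (intro integral_cong) (auto simp: bump_outside)
    then show ?thesis by simp
  qed
  have high: "\<phi> t = 0" if "max a b + e \<le> t" for t
  proof -
    let ?I = "integral {0..e} (bump e 0)"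
    have I: "((\<lambda>t. complex_of_real (bump e c t)) has_integral complex_of_real ?I) {0..t}"
      if "0 < c" "c + e \<le> t" for c
      using that by (intro has_integral_of_real bump_has_integral) auto
    have "(?g has_integral complex_of_real ?I - complex_of_real ?I) {0..t}"
      by (intro has_integral_diff I) (use that ab in auto)
    then show ?thesis unfolding \<phi>_def by (simp add: integral_unique)
  qed
  have d: "(\<phi> has_vector_derivative ?g t) (at t)" for t
  proof (cases "0 < t")
    case True
    have "(\<phi> has_vector_derivative ?g t) (at t within {0..t + 1})"
      unfolding \<phi>_def by (rule integral_has_vector_derivative) (use True smooth_imp_continuous_on[OF smooth_g] in auto)
    then show ?thesis
      using True at_within_interior[of t "{0..t + 1}"] by simp
  next
    case False
    have "((\<lambda>_. 0) has_vector_derivative ?g t) (at t)"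
      using False ab by (simp add: bump_outside)
    then show ?thesis
      by (rule has_vector_derivative_transform_within_open[where S = "{..<min a b}"])
        (use False ab low in auto)
  qed
  have "dir_deriv 1 \<phi> = ?g" using dir_deriv_1_eq[OF d] by blast
  moreover have "\<phi> differentiable_on UNIV"
    using d unfolding differentiable_on_def by (blast intro: differentiableI_vector)
  moreover have "h differentiable_on UNIV" if "smooth h" for h :: "real \<Rightarrow> complex"
    using smooth_imp_differentiable[OF that] by (simp add: differentiable_on_def)
  moreover have "smooth (dir_deriv 1 h)" if "smooth h" for h :: "real \<Rightarrow> complex"
    using smooth_dir_deriv[OF that] by simp
  \<comment> \<open>The class consists of the primitive itself and all smooth functions; its
    derivative already belongs to the latter.\<close>
  ultimately have "smooth \<phi>"
    using smooth_g
    by (intro smooth_coinduct[where P = "\<lambda>h. h = \<phi> \<or> smooth h" and f = \<phi>]) auto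
  moreover have "compact {min a b..max a b + e}" "{min a b..max a b + e} \<subseteq> {0<..<T}"
    using ab by auto
  moreover have "\<phi> t = 0" if "t \<notin> {min a b..max a b + e}" for t
    using that low high by (metis atLeastAtMost_iff linear)
  ultimately have "\<phi> \<in> time_test T" unfolding time_test_def by blast
  then show ?thesis
    using that d vector_derivative_at by blast
qed

text \<open>The test function whose derivative is the difference of two equal bumps, starting at
  \<open>a\<close> and at \<open>b\<close>, shows that the weighted means of \<open>z\<close> just
  after \<open>a\<close> and just after \<open>b\<close> coincide. As the bumps shrink, these means
  tend to \<open>z a\<close> and \<open>z b\<close>.\<close>

lemma du_Bois_Reymond:
  fixes z :: "real \<Rightarrow> complex"
  assumes z: "continuous_on {0..T} z"
    and weak: "\<And>\<phi>. \<phi> \<in> time_test T \<Longrightarrow> integral {0..T} (\<lambda>t. z t * vector_derivative \<phi> (at t)) = 0"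
    and ab: "a \<in> {0<..<T}" "b \<in> {0<..<T}"
  shows "z a = z b"
proof -
  have le: "norm (z a - z b) \<le> 2 * \<epsilon>" if \<epsilon>: "0 < \<epsilon>" for \<epsilon>
  proof -
    have near: "\<exists>d>0. \<forall>e<d. \<forall>t\<in>{c..c + e}. norm (z t - z c) \<le> \<epsilon>" if "c \<in> {0<..<T}" for c
    proof -
      have c: "c \<in> {0..T}" using that by auto
      obtain d where d: "0 < d" "\<And>t. t \<in> {0..T} \<Longrightarrow> dist t c < d \<Longrightarrow> dist (z t) (z c) < \<epsilon>"
        using z[unfolded continuous_on_iff] c \<epsilon> by metis
      have "norm (z t - z c) \<le> \<epsilon>" if "e < min d (T - c)" "t \<in> {c..c + e}" for e t
        using d(2)[of t] that c by (auto simp: dist_norm)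
      moreover have "0 < min d (T - c)" using d that by auto
      ultimately show ?thesis by blast
    qed
    obtain da db where d: "0 < da" "\<And>e t. e < da \<Longrightarrow> t \<in> {a..a + e} \<Longrightarrow> norm (z t - z a) \<le> \<epsilon>"
      "0 < db" "\<And>e t. e < db \<Longrightarrow> t \<in> {b..b + e} \<Longrightarrow> norm (z t - z b) \<le> \<epsilon>"
      using near[OF ab(1)] near[OF ab(2)] by metis
    define m where "m = min (min da db) (min (T - a) (T - b))"
    define e where "e = m / 2"
    have "0 < m" "m \<le> da" "m \<le> db" "m \<le> T - a" "m \<le> T - b" using d ab by (auto simp: m_def)
    then have e: "0 < e" "e < da" "e < db" "a + e < T" "b + e < T"
      by (auto simp: e_def)
    define I where "I = integral {0..e} (bump e 0)"
    have I: "0 < I" unfolding I_def by (rule bump_integral_pos[OF e(1)])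
    have avg: "norm (integral {0..T} (\<lambda>t. z t * complex_of_real (bump e c t)) - z c * complex_of_real I) \<le> \<epsilon> * I"
      if c: "c \<in> {0<..<T}" "c + e < T" and zc: "\<And>t. t \<in> {c..c + e} \<Longrightarrow> norm (z t - z c) \<le> \<epsilon>" for c
    proof -
      have bI: "(bump e c has_integral I) {0..T}"
        unfolding I_def using c by (intro bump_has_integral) auto
      have "((\<lambda>t. z t * complex_of_real (bump e c t)) has_integral
          integral {0..T} (\<lambda>t. z t * complex_of_real (bump e c t))) {0..T}"
        by (intro integrable_integral integrable_continuous_real continuous_intros z continuous_on_bump)
      from has_integral_diff[OF this has_integral_mult_right[OF has_integral_of_real[OF bI], of "z c"]]
      have diff: "((\<lambda>t. (z t - z c) * complex_of_real (bump e c t)) has_integral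
          integral {0..T} (\<lambda>t. z t * complex_of_real (bump e c t)) - z c * complex_of_real I) {0..T}"
        by (simp add: left_diff_distrib)
      have pt: "norm ((z t - z c) * complex_of_real (bump e c t)) \<le> \<epsilon> * bump e c t" for t
      proof (cases "t \<in> {c..c + e}")
        case True
        then show ?thesis
          using zc[OF True] bump_nonneg[of e c t] by (simp add: norm_mult mult_right_mono)
      next
        case False
        then have "bump e c t = 0" by (intro bump_outside) auto
        then show ?thesis by simp
      qed
      have "norm (integral {0..T} (\<lambda>t. (z t - z c) * complex_of_real (bump e c t))) \<le> integral {0..T} (\<lambda>t. \<epsilon> * bump e c t)"
        using diff bI pt by (intro integral_norm_bound_integral) (auto intro: integrable_on_mult_right)
      then show ?thesis
        using integral_unique[OF diff] integral_unique[OF bI] by simp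
    qed
    let ?J = "\<lambda>c. integral {0..T} (\<lambda>t. z t * complex_of_real (bump e c t))"
    obtain \<phi> where \<phi>: "\<phi> \<in> time_test T"
      "\<And>t. vector_derivative \<phi> (at t) = complex_of_real (bump e a t) - complex_of_real (bump e b t)"
      using bump_difference_primitive[of e a b T] e ab by auto
    have i: "(\<lambda>t. z t * complex_of_real (bump e c t)) integrable_on {0..T}" for c
      by (intro integrable_continuous_real continuous_intros z continuous_on_bump)
    have "?J a - ?J b = 0"
      using weak[OF \<phi>(1)] i[of a] i[of b]
      by (simp add: \<phi>(2) right_diff_distrib Henstock_Kurzweil_Integration.integral_diff)
    then have eq: "(z a - z b) * complex_of_real I
        = (?J b - z b * complex_of_real I) - (?J a - z a * complex_of_real I)"
      by (simp add: algebra_simps)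
    have "norm (z a - z b) * I = norm ((z a - z b) * complex_of_real I)"
      using I by (simp add: norm_mult)
    also have "\<dots> \<le> norm (?J b - z b * complex_of_real I) + norm (?J a - z a * complex_of_real I)"
      unfolding eq by (rule norm_triangle_ineq4)
    also have "\<dots> \<le> \<epsilon> * I + \<epsilon> * I"
      using ab e d by (intro add_mono avg) auto
    finally have "norm (z a - z b) * I \<le> (2 * \<epsilon>) * I" by (simp add: mult_ac)
    then show ?thesis using I by (simp add: mult_le_cancel_right)
  qed
  have "norm (z a - z b) \<le> 0 + \<epsilon>" if "0 < \<epsilon>" for \<epsilon>
    using le[of "\<epsilon> / 2"] that by simp
  then have "norm (z a - z b) \<le> 0" by (rule field_le_epsilon)
  then show ?thesis by simp
qed

text \<open>Integration by parts against a primitive \<open>Z\<close> of the right-hand side turns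
  the weak equation into orthogonality of \<open>y - Z\<close> to all derivatives of test functions,
  so this difference is constant.\<close>

lemma weak_solution_integral_equation:
  fixes y :: "real \<Rightarrow> complex"
  assumes T: "0 < T"
    and cont: "continuous_on {0..T} y" "continuous_on {0..T} q" "continuous_on {0..T} F"
    and weak: "\<And>\<phi>. \<phi> \<in> time_test T \<Longrightarrow>
      integral {0..T} (\<lambda>t. y t * - D_t \<phi> t) + integral {0..T} (\<lambda>t. q t * y t * \<phi> t)
        = integral {0..T} (\<lambda>t. F t * \<phi> t)"
    and t: "t \<in> {0..T}"
  shows "y t = y 0 + integral {0..t} (\<lambda>s. \<i> * (F s - q s * y s))"
proof -
  define G where "G = (\<lambda>s. \<i> * (F s - q s * y s))"
  define Z where "Z t = integral {0..t} G" for t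
  have G: "continuous_on {0..T} G"
    unfolding G_def by (intro continuous_intros cont)
  have dZ: "(Z has_vector_derivative G t) (at t within {0..T})" if "t \<in> {0..T}" for t
    unfolding Z_def by (rule integral_has_vector_derivative[OF G that])
  have Z: "continuous_on {0..T} Z"
    using has_vector_derivative_continuous[OF dZ] by (simp add: continuous_on_eq_continuous_within)
  define z where "z t = y t - Z t" for t
  have z: "continuous_on {0..T} z"
    unfolding z_def by (intro continuous_intros cont Z)
  have orth: "integral {0..T} (\<lambda>t. z t * vector_derivative \<phi> (at t)) = 0" if \<phi>: "\<phi> \<in> time_test T" for \<phi>
  proof -
    let ?d = "\<lambda>t. vector_derivative \<phi> (at t)"
    note c = cont G Z time_test_continuous_on[OF \<phi>] time_test_derivative_continuous_on[OF \<phi>]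
    have i: "f integrable_on {0..T}" if "continuous_on {0..T} f" for f :: "real \<Rightarrow> complex"
      using that by (rule integrable_continuous_real)
    have "((\<lambda>t. Z t * ?d t + G t * \<phi> t) has_integral Z T * \<phi> T - Z 0 * \<phi> 0) {0..T}"
      using T by (intro fundamental_theorem_of_calculus has_vector_derivative_mult dZ
          has_vector_derivative_at_within[OF time_test_has_vector_derivative[OF \<phi>]]) auto
    then have "integral {0..T} (\<lambda>t. Z t * ?d t + G t * \<phi> t) = 0"
      using time_test_endpoints[OF \<phi>] by (simp add: integral_unique)
    then have 1: "integral {0..T} (\<lambda>t. Z t * ?d t) = - integral {0..T} (\<lambda>t. G t * \<phi> t)"
      by (subst (asm) Henstock_Kurzweil_Integration.integral_add)
        (auto intro!: i continuous_intros c simp: add_eq_0_iff2)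
    have "integral {0..T} (\<lambda>t. y t * - D_t \<phi> t) = \<i> * integral {0..T} (\<lambda>t. y t * ?d t)"
      unfolding D_t_def by (simp add: mult.left_commute[of _ \<i>])
    moreover have "integral {0..T} (\<lambda>t. F t * \<phi> t) - integral {0..T} (\<lambda>t. q t * y t * \<phi> t)
        = integral {0..T} (\<lambda>t. F t * \<phi> t - q t * y t * \<phi> t)"
      by (intro Henstock_Kurzweil_Integration.integral_diff[symmetric] i continuous_intros c)
    moreover have "\<i> * integral {0..T} (\<lambda>t. F t * \<phi> t - q t * y t * \<phi> t) = integral {0..T} (\<lambda>t. G t * \<phi> t)"
      by (simp add: G_def left_diff_distrib mult.assoc flip: integral_mult_right)
    ultimately have "\<i> * (\<i> * integral {0..T} (\<lambda>t. y t * ?d t)) = integral {0..T} (\<lambda>t. G t * \<phi> t)"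
      using weak[OF \<phi>] by (metis add_diff_cancel_right')
    then have 2: "integral {0..T} (\<lambda>t. y t * ?d t) = - integral {0..T} (\<lambda>t. G t * \<phi> t)"
      by (simp add: minus_equation_iff)
    have "integral {0..T} (\<lambda>t. z t * ?d t) = integral {0..T} (\<lambda>t. y t * ?d t) - integral {0..T} (\<lambda>t. Z t * ?d t)"
      unfolding z_def left_diff_distrib
      by (intro Henstock_Kurzweil_Integration.integral_diff i continuous_intros c)
    then show ?thesis using 1 2 by simp
  qed
  have const: "z a = z (T / 2)" if "a \<in> {0<..<T}" for a
    by (rule du_Bois_Reymond[OF z orth that]) (use T in auto)
  \<comment> \<open>Test functions see the open interval only; continuity adds the end points, among
    them the time 0 of the initial datum.\<close>
  have "z a = z (T / 2)" if "a \<in> {0..T}" for a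
  proof (rule continuous_constant_on_closure[of "{0<..<T}" z])
    show "continuous_on (closure {0<..<T}) z" using z T by simp
    show "a \<in> closure {0<..<T}" using that T by simp
  qed (rule const)
  from this[OF t] this[of 0] have "z t = z 0" using T by simp
  moreover have "Z 0 = 0" by (simp add: Z_def)
  ultimately show ?thesis
    by (simp add: z_def Z_def G_def algebra_simps)
qed

section \<open>Weak solutions mode by mode\<close>

text \<open>The factor is the symbol of the operator at \<xi>. The derivatives fall on the test
  function of frequency -\<xi>; its sign cancels the sign of the transposed derivative.\<close>

lemma spatial_part_mode:
  assumes u: "u t \<in> distributions"
  shows "spatial_part a2 a1 a0 u t (mode (- \<xi>)) =
    (a2 t * (\<Sum>j\<in>UNIV. (of_int (\<xi> $ j))\<^sup>2) + (\<Sum>j\<in>UNIV. a1 j t * of_int (\<xi> $ j)) + a0 t)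
      * u t (mode (- \<xi>))"
proof -
  let ?m = "mode (- \<xi>)"
  note T = mode_torus_smooth[of "- \<xi>"]
  have d: "dir_deriv (axis j 1) (\<lambda>x. z * ?m x) = (\<lambda>x. z * (- \<i> * of_int (\<xi> $ j)) * ?m x)" for z j
    by (simp add: dir_deriv_cmult smooth_mode dir_deriv_mode inner_axis' mult_ac)
  have "dist_partial j (dist_partial j (u t)) ?m = - (of_int (\<xi> $ j))\<^sup>2 * u t ?m" for j
  proof -
    let ?z = "- \<i> * of_int (\<xi> $ j) :: complex"
    have "dir_deriv (axis j 1) ?m = (\<lambda>x. ?z * ?m x)"
      using d[of j 1] by simp
    then have "dist_partial j (dist_partial j (u t)) ?m = u t (\<lambda>x. ?z * ?z * ?m x)"
      using T torus_smooth_cmult[OF T, of ?z] d[of j ?z] by (simp add: dist_partial_def)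
    also have "\<dots> = ?z * ?z * u t ?m"
      by (rule distributions_cmult[OF u T])
    finally show ?thesis by (simp add: power2_eq_square algebra_simps)
  qed
  moreover have "dist_D j (u t) ?m = of_int (\<xi> $ j) * u t ?m" for j
    using T D_x_cmult_mode[of j 1 "- \<xi>"] distributions_cmult[OF u T, of "- of_int (\<xi> $ j)"]
    by (simp add: dist_D_def)
  ultimately show ?thesis
    by (simp add: spatial_part_def dist_Laplace_def sum_negf sum_distrib_right sum_distrib_left algebra_simps)
qed

lemma sobolev_curve_in_space:
  assumes "u \<in> curves T (sobolev_topology r)" "t \<in> {0..T}"
  shows "u t \<in> sobolev r"
proof -
  have "u t \<in> topspace (sobolev_topology r)"
    using continuous_map_image_subset_topspace[of "top_of_set {0..T}" "sobolev_topology r" u] assms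
    by (auto simp: curves_def)
  then show ?thesis
    by (auto simp: sobolev_topology_def seminorm_topology_def)
qed

text \<open>A Fourier coefficient times its weight is bounded by the Sobolev norm, hence the radius
  \<open>e * w\<close> of the ball.\<close>

lemma sobolev_curve_continuous_on:
  assumes u: "u \<in> curves T (sobolev_topology r)"
  shows "continuous_on {0..T} (\<lambda>t. fourier (u t) \<xi>)"
  unfolding continuous_on_iff
proof (intro ballI allI impI)
  fix t e :: real assume t: "t \<in> {0..T}" and e: "0 < e"
  note S = sobolev_curve_in_space[OF u]
  define w where "w = sobolev_weight r \<xi>"
  have w: "0 < w" by (simp add: w_def sobolev_weight_pos)
  let ?V = "{v \<in> sobolev r. sobolev_norm r (\<lambda>\<phi>. v \<phi> - u t \<phi>) < e * w}"
  have "openin (sobolev_topology r) ?V"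
    unfolding sobolev_topology_def seminorm_topology_def
    by (rule topology_generated_by_Basis)
      (use S[OF t] e w in \<open>intro CollectI exI[of _ "sobolev_norm r"] exI[of _ "u t"] exI[of _ "e * w"], simp\<close>)
  then have "openin (top_of_set {0..T}) {s \<in> {0..T}. u s \<in> ?V}"
    using u openin_continuous_map_preimage[of "top_of_set {0..T}" "sobolev_topology r" u ?V]
    by (simp add: curves_def)
  moreover have "sobolev_norm r (\<lambda>\<phi>. u t \<phi> - u t \<phi>) = 0"
    by (simp add: sobolev_norm_def fourier_def)
  then have "t \<in> {s \<in> {0..T}. u s \<in> ?V}"
    using t S[OF t] e w by simp
  ultimately obtain d where d: "0 < d" "\<And>s. s \<in> {0..T} \<Longrightarrow> dist s t < d \<Longrightarrow> u s \<in> ?V"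
    unfolding openin_euclidean_subtopology_iff by blast
  have "dist (fourier (u s) \<xi>) (fourier (u t) \<xi>) < e" if s: "s \<in> {0..T}" "dist s t < d" for s
  proof -
    have "(\<lambda>\<phi>. u s \<phi> - u t \<phi>) \<in> sobolev r"
      using sobolev_combination(1)[OF S[OF s(1)] S[OF t], of 1 "-1"] by simp
    from norm_fourier_le_sobolev_norm[OF this, of \<xi>]
    have "norm (fourier (\<lambda>\<phi>. u s \<phi> - u t \<phi>) \<xi>) * w < e * w"
      using d(2)[OF s] unfolding w_def by simp
    then show ?thesis using w by (simp add: fourier_def dist_norm)
  qed
  then show "\<exists>d>0. \<forall>s\<in>{0..T}. dist s t < d \<longrightarrow> dist (fourier (u s) \<xi>) (fourier (u t) \<xi>) < e"
    using d(1) by blast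
qed

section \<open>The exploding forcing term\<close>

text \<open>On the window the equation behaves like a backward heat equation. \<open>A\<close>
  controls the lower-order terms; it involves \<open>a1\<close> in direction \<open>j0\<close> only,
  because all forced frequencies lie on that axis.\<close>

locale backward_window =
  fixes T :: real and a2 a0 :: "real \<Rightarrow> complex" and a1 :: "'n::finite \<Rightarrow> real \<Rightarrow> complex"
    and j0 :: 'n and \<alpha> \<beta> \<gamma> A :: real
  assumes cont_a2: "continuous_on {0..T} a2"
    and cont_a1: "\<And>j. continuous_on {0..T} (a1 j)"
    and cont_a0: "continuous_on {0..T} a0"
    and window: "0 \<le> \<alpha>" "\<alpha> < \<beta>" "\<beta> \<le> T"
    and \<gamma>: "0 < \<gamma>" "\<And>t. t \<in> {\<alpha>..\<beta>} \<Longrightarrow> \<gamma> \<le> Im (a2 t)"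
    and A: "\<And>t. t \<in> {0..T} \<Longrightarrow> norm (a1 j0 t) \<le> A" "\<And>t. t \<in> {0..T} \<Longrightarrow> norm (a0 t) \<le> A"
begin

definition m :: real where "m = (\<alpha> + \<beta>) / 2"

text \<open>These points start at \<alpha> and increase to \<open>m\<close>, with gaps
  \<open>(m - \<alpha>) / ((k + 1) * (k + 2))\<close>; polynomially short windows cost only a power
  of k.\<close>

definition \<tau> :: "nat \<Rightarrow> real" where "\<tau> k = m - (m - \<alpha>) / (real k + 1)"

text \<open>A truncated parabola is continuous and has an explicit integral, one sixth of the cube
  of the window length.\<close>

definition pulse :: "nat \<Rightarrow> real \<Rightarrow> real" where
  "pulse k t = max 0 ((t - \<tau> k) * (\<tau> (Suc k) - t))"

definition q :: "nat \<Rightarrow> real \<Rightarrow> complex" where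
  "q k t = a2 t * (of_nat k)\<^sup>2 + a1 j0 t * of_nat k + a0 t"

definition Q :: "nat \<Rightarrow> real \<Rightarrow> complex" where "Q k t = integral {0..t} (q k)"

definition amplitude :: "nat \<Rightarrow> real \<Rightarrow> complex" where
  "amplitude k t = of_real (exp (- real k) * pulse k t) * exp (- \<i> * (Q k t - Q k m))"

definition active :: "real \<Rightarrow> nat" where "active t = (SOME k. pulse k t \<noteq> 0)"

section \<open>Time windows and pulses\<close>

lemma m: "\<alpha> < m" "m < \<beta>"
  using window by (auto simp: m_def)

lemma A_nonneg: "0 \<le> A"
  using order_trans[OF norm_ge_zero A(1)[of 0]] window by simp

lemma \<tau>_less: "k < l \<Longrightarrow> \<tau> k < \<tau> l"
  using m by (simp add: \<tau>_def divide_strict_left_mono)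

lemma \<tau>_bounds: "\<alpha> \<le> \<tau> k" "\<tau> k < m"
  using m divide_left_mono[of 1 "real k + 1" "m - \<alpha>"] by (auto simp: \<tau>_def)

lemma pulse_nonneg: "0 \<le> pulse k t"
  by (simp add: pulse_def)

lemma pulse_support:
  assumes "pulse k t \<noteq> 0"
  shows "\<tau> k < t" "t < \<tau> (Suc k)"
proof -
  have "0 < (t - \<tau> k) * (\<tau> (Suc k) - t)"
  proof (rule ccontr)
    assume "\<not> ?thesis"
    then have "pulse k t = 0" by (simp add: pulse_def)
    then show False using assms by simp
  qed
  then show "\<tau> k < t" "t < \<tau> (Suc k)"
    using \<tau>_less[of k "Suc k"] by (auto simp: zero_less_mult_iff)
qed

lemma pulse_unique:
  assumes "pulse k t \<noteq> 0" "pulse l t \<noteq> 0"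
  shows "k = l"
proof -
  have False if "i < j" "pulse i t \<noteq> 0" "pulse j t \<noteq> 0" for i j
    using pulse_support[OF that(2)] pulse_support[OF that(3)] \<tau>_less[of "Suc i" j] that(1)
    by (cases "Suc i = j") auto
  then show ?thesis using assms by (meson linorder_neqE_nat)
qed

lemma pulse_active:
  assumes "k \<noteq> active t"
  shows "pulse k t = 0"
proof (rule ccontr)
  assume k: "pulse k t \<noteq> 0"
  then have "pulse (active t) t \<noteq> 0" unfolding active_def by (rule someI)
  then show False using pulse_unique[OF k] assms by blast
qed

lemma pulse_le: "pulse k t \<le> (m - \<alpha>)\<^sup>2"
proof (cases "pulse k t = 0")
  case False
  then have "(t - \<tau> k) * (\<tau> (Suc k) - t) \<le> (m - \<alpha>) * (m - \<alpha>)"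
    using pulse_support[OF False] \<tau>_bounds[of k] \<tau>_bounds[of "Suc k"] by (intro mult_mono) auto
  then show ?thesis by (simp add: pulse_def power2_eq_square)
qed simp

lemma continuous_on_pulse: "continuous_on S (pulse k)"
  unfolding pulse_def by (intro continuous_intros)

lemma pulse_integral_ge:
  "((m - \<alpha>) / ((real k + 1) * (real k + 2))) ^ 3 / 6 \<le> integral {0..\<beta>} (pulse k)"
proof -
  let ?a = "\<tau> k" and ?b = "\<tau> (Suc k)"
  let ?G = "\<lambda>t. (t - ?a)\<^sup>2 * (?b - ?a) / 2 - (t - ?a) ^ 3 / 3"
  have ab: "?a \<le> ?b" using \<tau>_less[of k "Suc k"] by simp
  have "((\<lambda>t. (t - ?a) * (?b - t)) has_integral ?G ?b - ?G ?a) {?a..?b}"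
  proof (rule fundamental_theorem_of_calculus[OF ab])
    fix t
    have "(?G has_real_derivative (t - ?a) * (?b - t)) (at t within {?a..?b})"
      by (auto intro!: derivative_eq_intros simp: power2_eq_square field_simps)
    then show "(?G has_vector_derivative (t - ?a) * (?b - t)) (at t within {?a..?b})"
      by (simp add: has_real_derivative_iff_has_vector_derivative)
  qed
  moreover have "?G ?b - ?G ?a = (?b - ?a) ^ 3 / 6"
    by (simp add: power2_eq_square power3_eq_cube field_simps)
  ultimately have "(?b - ?a) ^ 3 / 6 = integral {?a..?b} (\<lambda>t. (t - ?a) * (?b - t))"
    by (simp add: integral_unique)
  also have "\<dots> = integral {?a..?b} (pulse k)"
    by (intro integral_cong) (auto simp: pulse_def)
  also have "\<dots> \<le> integral {0..\<beta>} (pulse k)"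
    using window m \<tau>_bounds[of k] \<tau>_bounds[of "Suc k"]
    by (intro integral_subset_le integrable_continuous_real continuous_on_pulse) (auto simp: pulse_nonneg)
  finally have "(?b - ?a) ^ 3 / 6 \<le> integral {0..\<beta>} (pulse k)" .
  moreover have "?b - ?a = (m - \<alpha>) / ((real k + 1) * (real k + 2))"
  proof -
    have "?b - ?a = (m - \<alpha>) * (1 / (real k + 1) - 1 / (real k + 2))"
      by (simp add: \<tau>_def right_diff_distrib add.commute)
    also have "1 / (real k + 1) - 1 / (real k + 2) = 1 / ((real k + 1) * (real k + 2))"
      by (simp add: diff_frac_eq)
    finally show ?thesis by simp
  qed
  ultimately show ?thesis by simp
qed

section \<open>Growth of the homogeneous solution\<close>

lemma continuous_on_q: "continuous_on {0..T} (q k)"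
  unfolding q_def by (intro continuous_intros cont_a2 cont_a1 cont_a0)

lemma Q_has_vector_derivative: "t \<in> {0..T} \<Longrightarrow> (Q k has_vector_derivative q k t) (at t within {0..T})"
  unfolding Q_def using integral_has_vector_derivative[OF continuous_on_q] .

lemma continuous_on_Q: "continuous_on {0..T} (Q k)"
  using has_vector_derivative_continuous[OF Q_has_vector_derivative]
  by (simp add: continuous_on_eq_continuous_within)

lemma Im_q_ge:
  assumes "t \<in> {\<alpha>..\<beta>}"
  shows "\<gamma> * (real k)\<^sup>2 - A * real k - A \<le> Im (q k t)"
proof -
  have t: "t \<in> {0..T}" using assms window by auto
  have "\<gamma> * (real k)\<^sup>2 \<le> Im (a2 t) * (real k)\<^sup>2"
    using \<gamma>(2)[OF assms] by (intro mult_right_mono) auto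
  moreover have "- A * real k \<le> Im (a1 j0 t) * real k"
    using A(1)[OF t] abs_Im_le_cmod[of "a1 j0 t"] by (intro mult_right_mono) auto
  moreover have "- A \<le> Im (a0 t)"
    using A(2)[OF t] abs_Im_le_cmod[of "a0 t"] by linarith
  moreover have "Im (q k t) = Im (a2 t) * (real k)\<^sup>2 + Im (a1 j0 t) * real k + Im (a0 t)"
    by (simp add: q_def power2_eq_square)
  ultimately show ?thesis by simp
qed

text \<open>Used on both sides of the midpoint: with \<open>t = m\<close> it bounds the homogeneous
  solution before \<open>m\<close>, with \<open>s = m\<close> it makes it explode after
  \<open>m\<close>.\<close>

lemma Im_Q_diff_ge:
  assumes "\<alpha> \<le> s" "s \<le> t" "t \<le> \<beta>"
  shows "(t - s) * (\<gamma> * (real k)\<^sup>2 - A * real k - A) \<le> Im (Q k t - Q k s)"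
proof -
  have "(q k has_integral Q k t - Q k s) {s..t}"
  proof (rule fundamental_theorem_of_calculus[OF assms(2)])
    fix x assume "x \<in> {s..t}"
    then have "x \<in> {0..T}" and sub: "{s..t} \<subseteq> {0..T}" using assms window by auto
    then show "(Q k has_vector_derivative q k x) (at x within {s..t})"
      using Q_has_vector_derivative has_vector_derivative_within_subset by blast
  qed
  from has_integral_linear[OF this bounded_linear_Im]
  have 1: "((\<lambda>x. Im (q k x)) has_integral Im (Q k t - Q k s)) {s..t}" by (simp add: o_def)
  have 2: "((\<lambda>_. \<gamma> * (real k)\<^sup>2 - A * real k - A) has_integral
      (t - s) * (\<gamma> * (real k)\<^sup>2 - A * real k - A)) {s..t}"
    using has_integral_const_real[of "\<gamma> * (real k)\<^sup>2 - A * real k - A" s t] assms by simp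
  show ?thesis
    by (rule has_integral_le[OF 2 1], rule Im_q_ge) (use assms in auto)
qed

lemma norm_exp_Q: "norm (exp (- \<i> * (Q k t - Q k m))) = exp (Im (Q k t - Q k m))"
  by simp

lemma amplitude_decay:
  "norm (amplitude k t) \<le> ((m - \<alpha>)\<^sup>2 * exp ((m - \<alpha>) * (A + A\<^sup>2 / (4 * \<gamma>)))) * exp (- real k)"
proof (cases "pulse k t = 0")
  case True
  then show ?thesis by (simp add: amplitude_def)
next
  case False
  note s = pulse_support[OF False]
  have t: "\<alpha> < t" "t < m"
    using s \<tau>_bounds[of k] \<tau>_bounds[of "Suc k"] by auto
  \<comment> \<open>Completing the square: for small k the linear term may dominate, but the loss
    \<open>A\<^sup>2 / (4 * \<gamma>)\<close> does not depend on k.\<close>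
  have "0 \<le> (\<gamma> * real k - A / 2)\<^sup>2 / \<gamma>" using \<gamma>(1) by simp
  also have "\<dots> = \<gamma> * (real k)\<^sup>2 - A * real k + A\<^sup>2 / (4 * \<gamma>)"
    using \<gamma>(1) by (simp add: power2_eq_square field_simps)
  finally have "- (A + A\<^sup>2 / (4 * \<gamma>)) \<le> \<gamma> * (real k)\<^sup>2 - A * real k - A" by simp
  then have "(m - t) * - (A + A\<^sup>2 / (4 * \<gamma>)) \<le> (m - t) * (\<gamma> * (real k)\<^sup>2 - A * real k - A)"
    using t by (intro mult_left_mono) auto
  also have "\<dots> \<le> Im (Q k m - Q k t)"
    using Im_Q_diff_ge[of t m k] t m by simp
  finally have "- ((m - t) * (A + A\<^sup>2 / (4 * \<gamma>))) \<le> Im (Q k m - Q k t)"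
    unfolding mult_minus_right .
  then have "Im (Q k t - Q k m) \<le> (m - t) * (A + A\<^sup>2 / (4 * \<gamma>))" by simp
  also have "\<dots> \<le> (m - \<alpha>) * (A + A\<^sup>2 / (4 * \<gamma>))"
    using t A_nonneg \<gamma>(1) by (intro mult_right_mono) auto
  finally have "exp (- real k) * pulse k t * exp (Im (Q k t - Q k m))
      \<le> exp (- real k) * (m - \<alpha>)\<^sup>2 * exp ((m - \<alpha>) * (A + A\<^sup>2 / (4 * \<gamma>)))"
    using pulse_le[of k t] pulse_nonneg[of k t] by (intro mult_mono) auto
  moreover have "norm (amplitude k t) = exp (- real k) * pulse k t * exp (Im (Q k t - Q k m))"
    unfolding amplitude_def norm_mult norm_exp_Q norm_of_real using pulse_nonneg[of k t] by simp
  ultimately show ?thesis by (simp only: mult_ac)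
qed

sublocale mode_curve "{0..T}" amplitude active j0
  "(m - \<alpha>)\<^sup>2 * exp ((m - \<alpha>) * (A + A\<^sup>2 / (4 * \<gamma>)))"
proof
  show "continuous_on {0..T} (amplitude k)" for k
    unfolding amplitude_def by (intro continuous_intros continuous_on_pulse continuous_on_Q)
  show "amplitude k t = 0" if "k \<noteq> active t" for k t
    using pulse_active[OF that] by (simp add: amplitude_def)
qed (rule amplitude_decay)

text \<open>Since the pulse of \<open>amplitude\<close> comes with the homogeneous solution as a factor, the integrating
  factor cancels all phases and only the integral of the pulse remains.\<close>

lemma norm_solution:
  fixes y :: "real \<Rightarrow> complex"
  assumes cont: "continuous_on {0..T} y"
    and y: "\<And>t. t \<in> {0..T} \<Longrightarrow> y t = integral {0..t} (\<lambda>s. \<i> * (amplitude k s - q k s * y s))"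
  shows "norm (y \<beta>) = exp (- real k) * integral {0..\<beta>} (pulse k) * exp (Im (Q k \<beta> - Q k m))"
proof -
  \<comment> \<open>The integrating factor, that is, the reciprocal of the homogeneous solution
    contained in \<open>amplitude\<close>.\<close>
  define E where "E t = exp (\<i> * (Q k t - Q k m))" for t
  have dE: "(E has_vector_derivative \<i> * q k t * E t) (at t within {0..T})" if "t \<in> {0..T}" for t
  proof -
    have "((\<lambda>t. \<i> * (Q k t - Q k m)) has_vector_derivative \<i> * q k t) (at t within {0..T})"
      using Q_has_vector_derivative[OF that, of k] by (auto intro!: derivative_eq_intros)
    from field_vector_diff_chain_within[OF this DERIV_subset[OF DERIV_exp subset_UNIV]]
    show ?thesis by (simp add: E_def[abs_def] o_def)
  qed
  have dy: "(y has_vector_derivative \<i> * (amplitude k t - q k t * y t)) (at t within {0..T})"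
    if t: "t \<in> {0..T}" for t
  proof (rule has_vector_derivative_transform[OF t])
    show "((\<lambda>t. integral {0..t} (\<lambda>s. \<i> * (amplitude k s - q k s * y s)))
        has_vector_derivative \<i> * (amplitude k t - q k t * y t)) (at t within {0..T})"
      using t by (intro integral_has_vector_derivative continuous_intros continuous_c continuous_on_q cont)
  qed (use y in auto)
  have "((\<lambda>t. \<i> * of_real (exp (- real k)) * of_real (pulse k t)) has_integral y \<beta> * E \<beta> - y 0 * E 0) {0..\<beta>}"
  proof (rule fundamental_theorem_of_calculus)
    fix t assume "t \<in> {0..\<beta>}"
    then have t: "t \<in> {0..T}" using window by auto
    have "exp (- \<i> * (Q k t - Q k m)) * E t = 1"
      by (simp add: E_def flip: exp_add)
    then have "amplitude k t * E t = of_real (exp (- real k) * pulse k t)"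
      unfolding amplitude_def mult.assoc by simp
    then have "y t * (\<i> * q k t * E t) + \<i> * (amplitude k t - q k t * y t) * E t
        = \<i> * of_real (exp (- real k)) * of_real (pulse k t)"
      by (simp add: algebra_simps)
    then have "((\<lambda>t. y t * E t) has_vector_derivative \<i> * of_real (exp (- real k)) * of_real (pulse k t)) (at t within {0..T})"
      using has_vector_derivative_mult[OF dy[OF t] dE[OF t]] by simp
    then show "((\<lambda>t. y t * E t) has_vector_derivative \<i> * of_real (exp (- real k)) * of_real (pulse k t)) (at t within {0..\<beta>})"
      by (rule has_vector_derivative_within_subset) (use window in auto)
  qed (use window in auto)
  moreover have "y 0 = 0" using y[of 0] window by simp
  moreover have "((\<lambda>t. \<i> * of_real (exp (- real k)) * of_real (pulse k t)) has_integral
      \<i> * of_real (exp (- real k)) * complex_of_real (integral {0..\<beta>} (pulse k))) {0..\<beta>}"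
    by (intro has_integral_mult_right has_integral_of_real integrable_integral
        integrable_continuous_real continuous_on_pulse)
  ultimately have eq: "y \<beta> * E \<beta> = \<i> * of_real (exp (- real k)) * complex_of_real (integral {0..\<beta>} (pulse k))"
    by (metis diff_zero has_integral_unique mult_zero_left)
  have "y \<beta> = y \<beta> * E \<beta> * exp (- \<i> * (Q k \<beta> - Q k m))"
    by (simp add: E_def mult.assoc flip: exp_add)
  moreover have "0 \<le> integral {0..\<beta>} (pulse k)"
    by (intro integral_nonneg integrable_continuous_real continuous_on_pulse pulse_nonneg)
  ultimately show ?thesis
    unfolding eq by (metis norm_mult norm_ii mult_1 norm_of_real abs_of_nonneg exp_ge_zero norm_exp_Q)
qed

text \<open>The exponent is quadratic in k with positive leading coefficient
  \<open>(\<beta> - m) * \<gamma>\<close>, which outweighs exp (-k), the sixth power of 1/k from the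
  pulse, and the Sobolev weight even for very negative \<open>r\<close>.\<close>

lemma growth:
  "filterlim (\<lambda>k. exp (- real k) * (((m - \<alpha>) / ((real k + 1) * (real k + 2))) ^ 3 / 6)
     * exp ((\<beta> - m) * (\<gamma> * (real k)\<^sup>2 - A * real k - A)) * (1 + real k) powr r) at_top sequentially"
proof -
  have "0 < m - \<alpha>" "0 < \<beta> - m" "0 < \<gamma>" using m \<gamma> by auto
  then show ?thesis
    by real_asymp
qed

text \<open>Membership in a Sobolev space of whatever order \<open>r\<close> bounds all weighted
  coefficients at the one time \<beta> by a single number, which \<open>growth\<close> contradicts.
  The datum is written \<open>force 0\<close>, so that it lies in the space at hand; its
  coefficients at the forced frequencies are zero.\<close>

lemma no_solution:
  assumes sol: "solves_Cauchy T a2 a1 a0 (restrict force {0..T}) (force 0) u"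
  shows False
proof -
  have T: "0 < T" using window by auto
  obtain r where u: "u \<in> curves T (sobolev_topology r)"
    and u0: "u 0 = force 0"
    and weak: "\<And>\<phi> \<psi>. \<phi> \<in> time_test T \<Longrightarrow> \<psi> \<in> torus_smooth \<Longrightarrow>
        weak_D_t T u \<phi> \<psi> + time_integral T (spatial_part a2 a1 a0 u) \<phi> \<psi>
        = time_integral T (restrict force {0..T}) \<phi> \<psi>"
    using sol unfolding solves_Cauchy_def by blast
  note S = sobolev_curve_in_space[OF u]
  define N where "N = sobolev_norm r (u \<beta>)"
  have "exp (- real k) * (((m - \<alpha>) / ((real k + 1) * (real k + 2))) ^ 3 / 6)
     * exp ((\<beta> - m) * (\<gamma> * (real k)\<^sup>2 - A * real k - A)) * (1 + real k) powr r \<le> N" for k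
  proof -
    let ?\<psi> = "mode (- freq k)"
    define y where "y t = u t ?\<psi>" for t
    have cont: "continuous_on {0..T} y"
      using sobolev_curve_continuous_on[OF u, of "freq k"] unfolding y_def fourier_eq .
    have "(\<Sum>j\<in>UNIV. (of_int (freq k $ j))\<^sup>2) = (of_nat k :: complex)\<^sup>2"
      "(\<Sum>j\<in>UNIV. a1 j t * of_int (freq k $ j)) = a1 j0 t * of_nat k" for t
      by (simp_all add: freq_def axis_def if_distrib if_distribR sum.delta cong: if_cong)
    then have spatial: "spatial_part a2 a1 a0 u t ?\<psi> = q k t * y t" if "t \<in> {0..T}" for t
      using S[OF that] by (simp add: spatial_part_mode sobolev_iff q_def y_def)
    have "integral {0..T} (\<lambda>t. y t * - D_t \<phi> t) + integral {0..T} (\<lambda>t. q k t * y t * \<phi> t)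
        = integral {0..T} (\<lambda>t. amplitude k t * \<phi> t)" if \<phi>: "\<phi> \<in> time_test T" for \<phi>
    proof -
      have "integral {0..T} (\<lambda>t. spatial_part a2 a1 a0 u t ?\<psi> * \<phi> t) = integral {0..T} (\<lambda>t. q k t * y t * \<phi> t)"
        "integral {0..T} (\<lambda>t. restrict force {0..T} t ?\<psi> * \<phi> t) = integral {0..T} (\<lambda>t. amplitude k t * \<phi> t)"
        by (intro integral_cong; simp add: spatial force_mode)+
      then show ?thesis
        using weak[OF \<phi> mode_torus_smooth[of "- freq k"]]
        by (simp add: weak_D_t_def time_integral_def y_def)
    qed
    note weak_solution_integral_equation[OF T cont continuous_on_q continuous_c this]
    \<comment> \<open>A pulse is nonzero only strictly after \<tau> k, and \<tau> k is at least
      \<alpha>, hence not negative.\<close>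
    moreover have "amplitude k 0 = 0"
      using pulse_support[of k 0] \<tau>_bounds[of k] window by (cases "pulse k 0 = 0") (auto simp: amplitude_def)
    then have "y 0 = 0"
      using force_mode[of 0 k] T by (simp add: y_def u0)
    ultimately have "norm (y \<beta>) = exp (- real k) * integral {0..\<beta>} (pulse k) * exp (Im (Q k \<beta> - Q k m))"
      using norm_solution[OF cont, of k] by simp
    moreover have "exp (- real k) * (((m - \<alpha>) / ((real k + 1) * (real k + 2))) ^ 3 / 6)
        * exp ((\<beta> - m) * (\<gamma> * (real k)\<^sup>2 - A * real k - A))
        \<le> exp (- real k) * integral {0..\<beta>} (pulse k) * exp (Im (Q k \<beta> - Q k m))"
      using pulse_integral_ge[of k] Im_Q_diff_ge[of m \<beta> k] m
      by (intro mult_mono mult_left_mono) (auto intro!: mult_nonneg_nonneg order_trans[OF _ pulse_integral_ge])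
    moreover have "norm (y \<beta>) * (1 + real k) powr r \<le> N"
      using norm_fourier_le_sobolev_norm[OF S[of \<beta>], of "freq k"] window
      by (simp add: y_def N_def fourier_eq sobolev_weight_def norm_freq)
    ultimately show ?thesis
      by (simp only:) (rule order_trans[OF mult_right_mono], assumption, rule powr_ge_zero)
  qed
  moreover have "\<forall>\<^sub>F k in sequentially. N < exp (- real k) * (((m - \<alpha>) / ((real k + 1) * (real k + 2))) ^ 3 / 6)
     * exp ((\<beta> - m) * (\<gamma> * (real k)\<^sup>2 - A * real k - A)) * (1 + real k) powr r"
    using growth[of r] unfolding filterlim_at_top_dense by (rule spec)
  ultimately have "\<forall>\<^sub>F k :: nat in sequentially. False"
    by (simp add: not_less[symmetric])
  then show False by simp
qed

text \<open>Existence is the part of well-posedness that is refuted. Space and topology enter only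
  through the force being a continuous curve.\<close>

lemma not_well_posed:
  assumes "\<And>t. force t \<in> X" "continuous_map (top_of_set {0..T}) \<tau>' force"
  shows "\<not> well_posed T a2 a1 a0 X \<tau>'"
proof
  assume wp: "well_posed T a2 a1 a0 X \<tau>'"
  \<comment> \<open>Curves are \<open>undefined\<close> outside the time interval, whereas
    \<open>force\<close> is defined at all times.\<close>
  have "continuous_map (top_of_set {0..T}) \<tau>' (restrict force {0..T})"
    using assms(2) by (rule continuous_map_eq) simp
  then have "restrict force {0..T} \<in> curves T \<tau>'"
    by (simp add: curves_def)
  then obtain u where "solves_Cauchy T a2 a1 a0 (restrict force {0..T}) (force 0) u"
    using wp assms(1) unfolding well_posed_def by blast
  then show False by (rule no_solution)
qed

end

lemma obtain_backward_window:
  fixes a2 a0 :: "real \<Rightarrow> complex" and a1 :: "'n::finite \<Rightarrow> real \<Rightarrow> complex"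
  assumes T: "0 < T" and cont: "continuous_on {0..T} a2" "\<And>j. continuous_on {0..T} (a1 j)" "continuous_on {0..T} a0"
    and "\<exists>t\<in>{0..T}. Im (a2 t) > 0"
  obtains \<alpha> \<beta> \<gamma> A where "backward_window T a2 a0 a1 j0 \<alpha> \<beta> \<gamma> A"
proof -
  obtain t0 where t0: "t0 \<in> {0..T}" "0 < Im (a2 t0)" using assms(5) by blast
  define \<gamma> where "\<gamma> = Im (a2 t0) / 2"
  have \<gamma>: "0 < \<gamma>" using t0 by (simp add: \<gamma>_def)
  obtain d where d: "0 < d" "\<And>t. t \<in> {0..T} \<Longrightarrow> dist t t0 < d \<Longrightarrow> dist (a2 t) (a2 t0) < \<gamma>"
    using cont(1)[unfolded continuous_on_iff] t0(1) \<gamma> by metis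
  \<comment> \<open>Clipping to the time interval allows \<open>t0\<close> to be an end point, and
    half of \<open>d\<close> keeps the distance strictly below \<open>d\<close> on the closed
    window.\<close>
  define \<alpha> \<beta> where "\<alpha> = max 0 (t0 - d / 2)" and "\<beta> = min T (t0 + d / 2)"
  have ab: "0 \<le> \<alpha>" "\<alpha> < \<beta>" "\<beta> \<le> T"
    using t0 d(1) T by (auto simp: \<alpha>_def \<beta>_def)
  have Im: "\<gamma> \<le> Im (a2 t)" if "t \<in> {\<alpha>..\<beta>}" for t
  proof -
    have "dist (a2 t) (a2 t0) < \<gamma>"
      using that d(1) by (intro d(2)) (auto simp: \<alpha>_def \<beta>_def dist_real_def)
    then have "\<bar>Im (a2 t - a2 t0)\<bar> < \<gamma>"
      using abs_Im_le_cmod[of "a2 t - a2 t0"] by (simp add: dist_norm)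
    then show ?thesis unfolding \<gamma>_def minus_complex.sel by linarith
  qed
  have bounded: "\<exists>B. \<forall>t\<in>{0..T}. norm (f t) \<le> B" if "continuous_on {0..T} f" for f :: "real \<Rightarrow> complex"
    using compact_imp_bounded[OF compact_continuous_image[OF that compact_Icc]] by (auto simp: bounded_iff)
  obtain B B' where "\<forall>t\<in>{0..T}. norm (a1 j0 t) \<le> B" "\<forall>t\<in>{0..T}. norm (a0 t) \<le> B'"
    using bounded[OF cont(2)] bounded[OF cont(3)] by metis
  then have "backward_window T a2 a0 a1 j0 \<alpha> \<beta> \<gamma> (max B B')"
    using cont ab \<gamma> Im by unfold_locales (auto simp: le_max_iff_disj)
  then show ?thesis by (rule that)
qed

theorem theorem5p2:
  fixes T :: real
    and a2 a0 :: "real \<Rightarrow> complex"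
    and a1 :: "'n::finite \<Rightarrow> real \<Rightarrow> complex"
  assumes "T > 0"
    and "continuous_on {0..T} a2"
    and "\<And>j. continuous_on {0..T} (a1 j)"
    and "continuous_on {0..T} a0"
    and "\<exists>t\<in>{0..T}. Im (a2 t) > 0"
  shows "\<not> well_posed_analytic T a2 a1 a0
    \<and> (\<forall>s\<ge>1. \<not> well_posed_gevrey s T a2 a1 a0)
    \<and> \<not> well_posed_C_infty T a2 a1 a0
    \<and> \<not> well_posed_sobolev T a2 a1 a0"
proof -
  obtain j0 :: 'n where True by simp
  obtain \<alpha> \<beta> \<gamma> A where "backward_window T a2 a0 a1 j0 \<alpha> \<beta> \<gamma> A"
    using obtain_backward_window[OF assms] .
  then interpret backward_window T a2 a0 a1 j0 \<alpha> \<beta> \<gamma> A .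
  have gevrey: "\<not> well_posed_gevrey s T a2 a1 a0" if "1 \<le> s" for s
    unfolding well_posed_gevrey_def
    by (rule not_well_posed[OF force_gevrey force_continuous_gevrey]) (rule that)+
  moreover have "\<not> well_posed_C_infty T a2 a1 a0"
    unfolding well_posed_C_infty_def by (rule not_well_posed[OF force_C_infty force_continuous_C_infty])
  moreover have "\<not> well_posed_sobolev T a2 a1 a0"
    unfolding well_posed_sobolev_def using not_well_posed[OF force_sobolev force_continuous_sobolev] by blast
  ultimately show ?thesis
    by (simp add: well_posed_analytic_def)
qed

end
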